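(* Let $2\le p<\infty$ and let $u\in W^{1,p}(\mathbb{R})$ be a compactly supported (real-valued) function. Then for all real $\kappa$ $$\int_{\mathbb{R}}|u'(x)+\kappa u(x)|^p\,dx\;\ge\;\int_{\mathbb{R}}|(u^\sharp)'(x)|^p\,dx,$$ where $u^\sharp$ is the symmetric decreasing rearrangement of $u$.
   Context: For a measurable function $u:\mathbb{R}\to\mathbb{R}$, its distribution function is $\mu_u(t)=\mathcal{L}^1(\{x\in\mathbb{R}:|u(x)|>t\})$, $t\ge 0$, where $\mathcal{L}^1$ is Lebesgue measure, and its symmetric decreasing rearrangement is the function $u^\sharp:\mathbb{R}\to[0,\infty]$ given by $$u^\sharp(0)=\sup_{\mathbb{R}}|u|,\qquad u^\sharp(x)=\inf\{t\ge 0:\mu_u(t)<2|x|\}\quad (x\ne 0).$$ Functions in $W^{1,p}(\mathbb{R})$ are identified with their continuous representatives. It is known that $u^\sharp\in W^{1,p}(\mathbb{R})$ when $u\in W^{1,p}(\mathbb{R})$ is compactly supported. *)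

theory Defs
  imports "HOL-Analysis.Analysis"
begin

definition compactly_supported :: "(real \<Rightarrow> real) \<Rightarrow> bool" where
  "compactly_supported f \<longleftrightarrow> compact (closure {x. f x \<noteq> 0})"

definition test_function :: "(real \<Rightarrow> real) \<Rightarrow> bool" where
  "test_function \<phi> \<longleftrightarrow>
     (\<forall>n. (deriv ^^ n) \<phi> differentiable_on UNIV) \<and> compactly_supported \<phi>"

definition locally_integrable :: "(real \<Rightarrow> real) \<Rightarrow> bool" where
  "locally_integrable f \<longleftrightarrow> (\<forall>a b. f absolutely_integrable_on {a..b})"

definition has_weak_derivative :: "(real \<Rightarrow> real) \<Rightarrow> (real \<Rightarrow> real) \<Rightarrow> bool" where
  "has_weak_derivative f g \<longleftrightarrow>
     locally_integrable f \<and> locally_integrable g \<and>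
     (\<forall>\<phi>. test_function \<phi> \<longrightarrow>
        (LINT x|lebesgue. f x * deriv \<phi> x) = - (LINT x|lebesgue. g x * \<phi> x))"

(* A weak derivative is unique up to null sets, so the integrals below do not depend
   on the representative chosen here. *)
definition weak_deriv :: "(real \<Rightarrow> real) \<Rightarrow> real \<Rightarrow> real" where
  "weak_deriv f = (SOME g. has_weak_derivative f g)"

definition Lp_functions :: "real \<Rightarrow> (real \<Rightarrow> real) set" where
  "Lp_functions p =
     {f \<in> borel_measurable lebesgue. integrable lebesgue (\<lambda>x. \<bar>f x\<bar> powr p)}"

(* Functions rather than a.e. classes; a continuous representative is singled out by a
   separate continuity assumption. *)
definition W1p :: "real \<Rightarrow> (real \<Rightarrow> real) set" where
  "W1p p = {f \<in> Lp_functions p. \<exists>g \<in> Lp_functions p. has_weak_derivative f g}"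

definition distribution_function :: "(real \<Rightarrow> real) \<Rightarrow> real \<Rightarrow> ennreal" where
  "distribution_function u t = emeasure lebesgue {x. \<bar>u x\<bar> > t}"

definition symm_decr_rearrangement :: "(real \<Rightarrow> real) \<Rightarrow> real \<Rightarrow> ennreal" where
  "symm_decr_rearrangement u x =
     (if x = 0 then (SUP y. ennreal \<bar>u y\<bar>)
      else Inf {ennreal t | t. t \<ge> 0 \<and> distribution_function u t < ennreal (2 * \<bar>x\<bar>)})"

end

theory Submission
  imports Defs
begin

text \<open>
  Let \<open>v\<close> be the rearrangement of \<open>u\<close>, and \<open>g\<close> the derivative of \<open>u\<close>.  The inequality is proved on
  each slab \<open>A = {s < \<bar>u\<bar> < t}\<close> between two values \<open>s = v y\<close> and \<open>t = v x\<close> of the rearrangement,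
  where \<open>0 \<le> x < y\<close>.  Equimeasurability says \<open>\<bar>A\<bar> \<le> 2 (y - x)\<close>.  Two facts about \<open>u\<close> enter: as
  \<open>\<bar>u\<bar>\<close> climbs from \<open>0\<close> through the slab and comes back, the integral of \<open>\<bar>g\<bar>\<close> over \<open>A\<close> is at least
  \<open>2 (t - s)\<close>; and \<open>u g\<close>, which on \<open>A\<close> is the derivative of half the square of \<open>\<bar>u\<bar>\<close> clamped between
  \<open>s\<close> and \<open>t\<close>, has integral zero over \<open>A\<close> (\<open>slab_integrals\<close>).  So the mixed term disappears when the square in
  \<open>\<bar>g + \<kappa> u\<bar>\<^sup>p = (g\<^sup>2 + 2 \<kappa> g u + \<kappa>\<^sup>2 u\<^sup>2) powr (p/2)\<close> is expanded.  As \<open>p \<ge> 2\<close>, the outer power is convex and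
  lies above its tangent, and the energy of \<open>u\<close> on \<open>A\<close> is at least
  \<open>2 (t - s)\<^sup>p / (y - x) powr (p - 1)\<close> (\<open>slab_energy\<close>).  This is the energy of a function that
  descends linearly from \<open>t\<close> to \<open>s\<close> between \<open>x\<close> and \<open>y\<close> and symmetrically on the other side.

  Summing over the disjoint slabs of a partition of the half-line bounds the Riesz sums
  \<open>\<Sum> \<bar>\<Delta>v\<bar>\<^sup>p / \<delta> powr (p - 1)\<close> by half the energy of \<open>u\<close> (\<open>rearr_partition_energy\<close>).  By F. Riesz's
  characterisation, \<open>v\<close> is then locally absolutely continuous (\<open>riesz_bound_imp_primitive\<close>) and
  the energy of \<open>v\<close> on the half-line obeys the same bound (\<open>riesz_bound_energy\<close>).  The first part
  goes through the Stieltjes measure of the monotone function \<open>v\<close> and its Radon-Nikodym density,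
  the second through difference quotients and Fatou's lemma.

  Weak derivatives are translated into indefinite integrals and back: a continuous function
  with a weak derivative is its indefinite integral (\<open>weak_derivative_imp_is_primitive\<close>), by
  testing with smooth approximations of indicator functions of intervals.
\<close>

section \<open>Indefinite integrals\<close>

text \<open>
  Local absolute continuity of \<open>u\<close> with derivative \<open>g\<close>, in integrated form.  Differentiability
  almost everywhere is a consequence, and the calculus below works with increments only.
\<close>

definition is_primitive :: "(real \<Rightarrow> real) \<Rightarrow> (real \<Rightarrow> real) \<Rightarrow> bool" where
  "is_primitive u g \<longleftrightarrow>
     locally_integrable g \<and> (\<forall>a b. a \<le> b \<longrightarrow> u b - u a = integral {a..b} g)"

lemma locally_integrableD:
  assumes "locally_integrable g"
  shows "g absolutely_integrable_on {a..b}" "g integrable_on {a..b}"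
    "(\<lambda>x. \<bar>g x\<bar>) integrable_on {a..b}"
  using assms set_lebesgue_integral_eq_integral(1)
  by (auto simp: locally_integrable_def absolutely_integrable_on_def)

lemma is_primitiveD:
  assumes "is_primitive u g"
  shows "locally_integrable g" "a \<le> b \<Longrightarrow> u b - u a = integral {a..b} g"
  using assms by (auto simp: is_primitive_def)

lemma is_primitive_continuous:
  assumes "is_primitive u g"
  shows "continuous_on S u"
proof -
  have "isCont u x" for x
  proof -
    have "continuous_on {x-1..x+1} (\<lambda>y. u (x-1) + integral {x-1..y} g)"
      by (intro continuous_intros indefinite_integral_continuous_1 locally_integrableD
          is_primitiveD[OF assms])
    moreover have "u (x-1) + integral {x-1..y} g = u y" if "y \<in> {x-1..x+1}" for y
      using is_primitiveD(2)[OF assms, of "x-1" y] that by auto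
    ultimately have "continuous_on {x-1..x+1} u"
      by (rule continuous_on_eq) auto
    then show ?thesis
      by (rule continuous_on_interior) auto
  qed
  then show ?thesis
    by (simp add: continuous_at_imp_continuous_on)
qed

lemma locally_integrable_times_bounded:
  assumes g: "locally_integrable g" and f: "f \<in> borel_measurable lebesgue"
    and bd: "\<And>a b. bounded (f ` {a..b})"
  shows "locally_integrable (\<lambda>x. f x * g x)"
  unfolding locally_integrable_def
proof safe
  fix a b :: real
  have "f \<in> borel_measurable (lebesgue_on {a..b})"
    using f measurable_restrict_space1 by blast
  then show "(\<lambda>x. f x * g x) absolutely_integrable_on {a..b}"
    by (intro absolutely_integrable_bounded_measurable_product_real bd locally_integrableD(1)[OF g]) auto
qed

lemma locally_integrable_times_continuous:
  assumes "locally_integrable g" and "continuous_on UNIV f"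
  shows "locally_integrable (\<lambda>x. f x * g x)"
proof (rule locally_integrable_times_bounded[OF assms(1)])
  show "f \<in> borel_measurable lebesgue"
    by (intro measurable_completion) (simp add: assms(2) borel_measurable_continuous_onI)
  show "bounded (f ` {a..b})" for a b
    using assms(2) by (intro compact_imp_bounded compact_continuous_image)
      (auto intro: continuous_on_subset)
qed

text \<open>
  The two sides agree up to \<open>\<epsilon>\<close> times the integral of \<open>l\<close> on every short interval.  Both errors
  are additive under concatenation, so the estimate survives on long intervals, and \<open>\<epsilon>\<close> is
  arbitrary.  The chain and product rules below are proved in this way.
\<close>

lemma increment_eq_integral_local:
  fixes \<Phi> k l :: "real \<Rightarrow> real"
  assumes k: "locally_integrable k" and l: "locally_integrable l"
    and loc: "\<And>\<epsilon> x. \<epsilon> > 0 \<Longrightarrow> \<exists>d>0. \<forall>a b. a \<le> x \<and> x \<le> b \<and> b - a < d \<longrightarrow>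
       \<bar>\<Phi> b - \<Phi> a - integral {a..b} k\<bar> \<le> \<epsilon> * integral {a..b} l"
    and ab: "a \<le> b"
  shows "\<Phi> b - \<Phi> a = integral {a..b} k"
proof -
  have *: "\<bar>\<Phi> b - \<Phi> a - integral {a..b} k\<bar> \<le> \<epsilon> * integral {a..b} l" if "\<epsilon> > 0" for \<epsilon>
    using ab
  proof (induction rule: Bolzano)
    case (trans a b c)
    have "integral {a..c} k = integral {a..b} k + integral {b..c} k"
      "integral {a..c} l = integral {a..b} l + integral {b..c} l"
      by (simp_all add: Henstock_Kurzweil_Integration.integral_combine[OF trans(3,4)]
          locally_integrableD(2) k l)
    then show ?case using trans by (simp add: algebra_simps)
  next
    case (local x)
    then show ?case using loc[OF that] by blast
  qed
  have "\<bar>\<Phi> b - \<Phi> a - integral {a..b} k\<bar> \<le> 0"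
  proof (rule field_le_epsilon)
    fix e :: real assume e: "e > 0"
    let ?I = "\<bar>integral {a..b} l\<bar> + 1"
    have "\<bar>\<Phi> b - \<Phi> a - integral {a..b} k\<bar> \<le> e / ?I * integral {a..b} l"
      using e by (intro *) auto
    also have "\<dots> \<le> e / ?I * ?I" using e by (intro mult_left_mono) auto
    finally show "\<bar>\<Phi> b - \<Phi> a - integral {a..b} k\<bar> \<le> 0 + e" using e by (simp split: if_splits)
  qed
  then show ?thesis by simp
qed

lemma locally_integrable_abs: "locally_integrable g \<Longrightarrow> locally_integrable (\<lambda>x. \<bar>g x\<bar>)"
  by (auto simp: locally_integrable_def intro: set_integrable_abs)

lemma locally_integrable_add:
  "locally_integrable f \<Longrightarrow> locally_integrable g \<Longrightarrow> locally_integrable (\<lambda>x. f x + g x)"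
  by (auto simp: locally_integrable_def)

lemma locally_integrable_diff:
  "locally_integrable f \<Longrightarrow> locally_integrable g \<Longrightarrow> locally_integrable (\<lambda>x. f x - g x)"
  by (auto simp: locally_integrable_def)

lemma locally_integrable_cmult:
  "locally_integrable g \<Longrightarrow> locally_integrable (\<lambda>x. c * g x)"
  by (auto simp: locally_integrable_def)

lemma locally_integrable_continuous:
  "continuous_on UNIV f \<Longrightarrow> locally_integrable f"
  by (auto simp: locally_integrable_def intro!: absolutely_integrable_continuous_real
      intro: continuous_on_subset)

lemma integral_abs_diff_le:
  fixes g h :: "real \<Rightarrow> real"
  assumes "locally_integrable g" "locally_integrable h" "locally_integrable l"
    and "\<And>x. x \<in> {a..b} \<Longrightarrow> \<bar>g x - h x\<bar> \<le> e * l x"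
  shows "\<bar>integral {a..b} g - integral {a..b} h\<bar> \<le> e * integral {a..b} l"
proof -
  have "\<bar>integral {a..b} (\<lambda>x. g x - h x)\<bar> \<le> integral {a..b} (\<lambda>x. e * l x)"
    unfolding real_norm_def[symmetric]
    by (rule integral_norm_bound_integral)
      (use assms in \<open>auto intro!: locally_integrableD locally_integrable_diff locally_integrable_cmult\<close>)
  then show ?thesis
    using assms by (simp add: integral_diff locally_integrableD)
qed

lemma is_primitive_chain:
  assumes u: "is_primitive u g" and F: "\<And>y. (F has_real_derivative f y) (at y)"
    and f: "continuous_on UNIV f"
  shows "is_primitive (\<lambda>x. F (u x)) (\<lambda>x. f (u x) * g x)"
proof -
  have g: "locally_integrable g" using u by (rule is_primitiveD)
  have cu: "continuous_on UNIV u" using u by (rule is_primitive_continuous)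
  have cfu: "continuous_on UNIV (\<lambda>x. f (u x))"
    using continuous_on_compose2[OF f cu] by auto
  have lk: "locally_integrable (\<lambda>x. f (u x) * g x)"
    by (rule locally_integrable_times_continuous[OF g cfu])
  show ?thesis
    unfolding is_primitive_def
  proof (intro conjI allI impI lk)
    fix a b :: real assume "a \<le> b"
    show "F (u b) - F (u a) = integral {a..b} (\<lambda>x. f (u x) * g x)"
    proof (rule increment_eq_integral_local[OF lk locally_integrable_abs[OF g] _ \<open>a \<le> b\<close>])
      fix \<epsilon> x :: real assume e: "\<epsilon> > 0"
      have "isCont (\<lambda>x. f (u x)) x"
        using cfu continuous_on_eq_continuous_at[OF open_UNIV] by blast
      then obtain d where d: "d > 0" "\<And>y. \<bar>y - x\<bar> < d \<Longrightarrow> \<bar>f (u y) - f (u x)\<bar> < \<epsilon>/2"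
        using e unfolding continuous_at_eps_delta dist_real_def by (meson half_gt_zero)
      show "\<exists>d>0. \<forall>a b. a \<le> x \<and> x \<le> b \<and> b - a < d \<longrightarrow>
          \<bar>F (u b) - F (u a) - integral {a..b} (\<lambda>x. f (u x) * g x)\<bar> \<le> \<epsilon> * integral {a..b} (\<lambda>x. \<bar>g x\<bar>)"
      proof (intro exI[of _ d] conjI allI impI d)
        fix a b assume ab: "a \<le> x \<and> x \<le> b \<and> b - a < d"
        obtain z where z: "z \<in> {a..b}" "F (u b) - F (u a) = f (u z) * (u b - u a)"
        proof (cases "u a = u b")
          case True then show ?thesis using ab that[of a] by auto
        next
          case False
          obtain y where y: "F (u b) - F (u a) = f y * (u b - u a)" "y \<in> closed_segment (u a) (u b)"
          proof (cases "u a < u b")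
            case True
            from MVT2[OF this, of F f] F obtain y where
              "u a < y" "y < u b" "F (u b) - F (u a) = (u b - u a) * f y" by blast
            then show ?thesis using that[of y] by (auto simp: closed_segment_eq_real_ivl mult.commute)
          next
            case F': False
            then have "u b < u a" using False by auto
            from MVT2[OF this, of F f] F obtain y where
              "u b < y" "y < u a" "F (u a) - F (u b) = (u a - u b) * f y" by blast
            then show ?thesis using that[of y] by (auto simp: closed_segment_eq_real_ivl algebra_simps)
          qed
          have "connected (u ` {a..b})"
            by (intro connected_continuous_image continuous_on_subset[OF cu]) auto
          then have "closed_segment (u a) (u b) \<subseteq> u ` {a..b}"
            using ab by (auto simp: connected_convex_1 convex_contains_segment)
          then show ?thesis using y that by auto
        qed
        have "\<bar>f (u z) - f (u r)\<bar> \<le> \<epsilon>" if "r \<in> {a..b}" for r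
        proof -
          have "\<bar>z - x\<bar> < d" "\<bar>r - x\<bar> < d" using z(1) that ab by auto
          from this[THEN d(2)] show ?thesis by linarith
        qed
        then have "\<bar>f (u z) * g r - f (u r) * g r\<bar> \<le> \<epsilon> * \<bar>g r\<bar>" if "r \<in> {a..b}" for r
          using that by (simp add: left_diff_distrib[symmetric] abs_mult mult_right_mono)
        then have "\<bar>integral {a..b} (\<lambda>r. f (u z) * g r) - integral {a..b} (\<lambda>x. f (u x) * g x)\<bar>
            \<le> \<epsilon> * integral {a..b} (\<lambda>x. \<bar>g x\<bar>)"
          by (intro integral_abs_diff_le locally_integrable_cmult lk g locally_integrable_abs)
        moreover have "integral {a..b} (\<lambda>r. f (u z) * g r) = F (u b) - F (u a)"
          using z is_primitiveD(2)[OF u, of a b] ab by simp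
        ultimately show "\<bar>F (u b) - F (u a) - integral {a..b} (\<lambda>x. f (u x) * g x)\<bar>
            \<le> \<epsilon> * integral {a..b} (\<lambda>x. \<bar>g x\<bar>)" by simp
      qed
    qed
  qed
qed

lemma is_primitive_times:
  assumes u: "is_primitive u g" and v: "is_primitive v h"
  shows "is_primitive (\<lambda>x. u x * v x) (\<lambda>x. u x * h x + v x * g x)"
proof -
  have g: "locally_integrable g" and h: "locally_integrable h"
    using is_primitiveD(1)[OF u] is_primitiveD(1)[OF v] by simp_all
  have cu: "continuous_on UNIV u" and cv: "continuous_on UNIV v"
    using is_primitive_continuous[OF u] is_primitive_continuous[OF v] by simp_all
  have lk: "locally_integrable (\<lambda>x. u x * h x + v x * g x)"
    by (intro locally_integrable_add locally_integrable_times_continuous g h cu cv)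
  have ll: "locally_integrable (\<lambda>x. \<bar>g x\<bar> + \<bar>h x\<bar>)"
    by (intro locally_integrable_add locally_integrable_abs g h)
  show ?thesis
    unfolding is_primitive_def
  proof (intro conjI allI impI lk)
    fix a b :: real assume "a \<le> b"
    show "u b * v b - u a * v a = integral {a..b} (\<lambda>x. u x * h x + v x * g x)"
    proof (rule increment_eq_integral_local[OF lk ll _ \<open>a \<le> b\<close>])
      fix \<epsilon> x :: real assume e: "\<epsilon> > 0"
      have "isCont u x" "isCont v x"
        using cu cv continuous_on_eq_continuous_at[OF open_UNIV] by blast+
      then obtain d1 d2 where d1: "d1 > 0" "\<And>y. \<bar>y - x\<bar> < d1 \<Longrightarrow> \<bar>u y - u x\<bar> < \<epsilon>/2"
        and d2: "d2 > 0" "\<And>y. \<bar>y - x\<bar> < d2 \<Longrightarrow> \<bar>v y - v x\<bar> < \<epsilon>/2"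
        using half_gt_zero[OF e] unfolding continuous_at_eps_delta dist_real_def by metis
      let ?d = "min d1 d2"
      show "\<exists>d>0. \<forall>a b. a \<le> x \<and> x \<le> b \<and> b - a < d \<longrightarrow>
          \<bar>u b * v b - u a * v a - integral {a..b} (\<lambda>x. u x * h x + v x * g x)\<bar>
            \<le> \<epsilon> * integral {a..b} (\<lambda>x. \<bar>g x\<bar> + \<bar>h x\<bar>)"
      proof (intro exI[of _ ?d] conjI allI impI)
        show "?d > 0" using d1 d2 by simp
        fix a b assume ab: "a \<le> x \<and> x \<le> b \<and> b - a < ?d"
        have U: "\<bar>u b - u r\<bar> \<le> \<epsilon>" and V: "\<bar>v a - v r\<bar> \<le> \<epsilon>" if "r \<in> {a..b}" for r
        proof -
          have "\<bar>b - x\<bar> < d1" "\<bar>r - x\<bar> < d1" "\<bar>a - x\<bar> < d2" "\<bar>r - x\<bar> < d2" using that ab by auto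
          from this(1,2)[THEN d1(2)] this(3,4)[THEN d2(2)]
          show "\<bar>u b - u r\<bar> \<le> \<epsilon>" "\<bar>v a - v r\<bar> \<le> \<epsilon>" by linarith+
        qed
        have "\<bar>(u b * h r + v a * g r) - (u r * h r + v r * g r)\<bar> \<le> \<epsilon> * (\<bar>g r\<bar> + \<bar>h r\<bar>)"
          if "r \<in> {a..b}" for r
        proof -
          have "(u b * h r + v a * g r) - (u r * h r + v r * g r) = (u b - u r) * h r + (v a - v r) * g r"
            by (simp add: algebra_simps)
          also have "\<bar>\<dots>\<bar> \<le> \<bar>u b - u r\<bar> * \<bar>h r\<bar> + \<bar>v a - v r\<bar> * \<bar>g r\<bar>"
            by (simp add: abs_mult[symmetric])
          also have "\<dots> \<le> \<epsilon> * \<bar>h r\<bar> + \<epsilon> * \<bar>g r\<bar>"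
            using U[OF that] V[OF that] by (intro add_mono mult_right_mono) auto
          finally show ?thesis by (simp add: algebra_simps)
        qed
        then have "\<bar>integral {a..b} (\<lambda>r. u b * h r + v a * g r)
              - integral {a..b} (\<lambda>x. u x * h x + v x * g x)\<bar> \<le> \<epsilon> * integral {a..b} (\<lambda>x. \<bar>g x\<bar> + \<bar>h x\<bar>)"
          by (intro integral_abs_diff_le locally_integrable_cmult lk ll g h locally_integrable_add) auto
        moreover have "integral {a..b} (\<lambda>r. u b * h r + v a * g r) = u b * v b - u a * v a"
        proof -
          have "integral {a..b} (\<lambda>r. u b * h r + v a * g r) = u b * (v b - v a) + v a * (u b - u a)"
            using is_primitiveD(2)[OF u, of a b] is_primitiveD(2)[OF v, of a b] ab
              locally_integrableD(2)[OF locally_integrable_cmult[OF g]]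
              locally_integrableD(2)[OF locally_integrable_cmult[OF h]]
            by (simp add: integral_add)
          then show ?thesis by (simp add: algebra_simps)
        qed
        ultimately show "\<bar>u b * v b - u a * v a - integral {a..b} (\<lambda>x. u x * h x + v x * g x)\<bar>
            \<le> \<epsilon> * integral {a..b} (\<lambda>x. \<bar>g x\<bar> + \<bar>h x\<bar>)" by simp
      qed
    qed
  qed
qed

lemma is_primitive_cong:
  assumes "is_primitive u g" "\<And>x. u x = v x" "\<And>x. g x = h x"
  shows "is_primitive v h"
proof -
  have "u = v" "g = h" using assms(2,3) by auto
  with assms(1) show ?thesis by simp
qed

lemma is_primitive_add:
  assumes "is_primitive u g" "is_primitive v h"
  shows "is_primitive (\<lambda>x. u x + v x) (\<lambda>x. g x + h x)"
  using assms
  by (auto simp: is_primitive_def locally_integrable_add integral_add locally_integrableD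
      add_diff_add)

lemma is_primitive_affine:
  assumes "is_primitive u g"
  shows "is_primitive (\<lambda>x. c * u x + d) (\<lambda>x. c * g x)"
  using assms
  by (auto simp: is_primitive_def locally_integrable_cmult right_diff_distrib[symmetric])

text \<open>Dominated convergence, with majorant \<open>\<bar>g\<bar>\<close>.\<close>

lemma is_primitive_limit:
  assumes g: "locally_integrable g"
    and prim: "\<And>n::nat. is_primitive (w n) (\<lambda>x. k n x * g x)"
    and bd: "\<And>n x. \<bar>k n x\<bar> \<le> 1"
    and k: "\<And>x. (\<lambda>n. k n x) \<longlonglongrightarrow> K x" and w: "\<And>x. (\<lambda>n. w n x) \<longlonglongrightarrow> W x"
  shows "is_primitive W (\<lambda>x. K x * g x)"
proof -
  have le: "norm (k n x * g x) \<le> \<bar>g x\<bar>" for n x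
    using mult_right_mono[OF bd[of n x], of "\<bar>g x\<bar>"] by (simp add: abs_mult)
  have lim: "(\<lambda>n. k n x * g x) \<longlonglongrightarrow> K x * g x" for x
    by (intro tendsto_mult k tendsto_const)
  have le': "norm (K x * g x) \<le> \<bar>g x\<bar>" for x
    by (rule tendsto_upperbound[OF tendsto_norm[OF lim]]) (use le in auto)
  have li: "locally_integrable (\<lambda>x. k n x * g x)" for n
    using is_primitiveD(1)[OF prim] .
  have "locally_integrable (\<lambda>x. K x * g x)"
    unfolding locally_integrable_def
    by (intro allI dominated_convergence_absolutely_integrable[OF _ locally_integrableD(3)[OF g] le' lim]
        locally_integrableD(1) li)
  moreover have "W b - W a = integral {a..b} (\<lambda>x. K x * g x)" if "a \<le> b" for a b
  proof (rule LIMSEQ_unique)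
    show "(\<lambda>n. w n b - w n a) \<longlonglongrightarrow> W b - W a"
      by (intro tendsto_diff w)
    have "(\<lambda>n. integral {a..b} (\<lambda>x. k n x * g x)) \<longlonglongrightarrow> integral {a..b} (\<lambda>x. K x * g x)"
      by (rule dominated_convergence(2)[OF _ locally_integrableD(3)[OF g] le lim])
        (rule locally_integrableD(2)[OF li])
    then show "(\<lambda>n. w n b - w n a) \<longlonglongrightarrow> integral {a..b} (\<lambda>x. K x * g x)"
      using is_primitiveD(2)[OF prim that] by simp
  qed
  ultimately show ?thesis by (simp add: is_primitive_def)
qed

lemma is_primitive_reflect:
  assumes "is_primitive u g"
  shows "is_primitive (\<lambda>x. u (- x)) (\<lambda>x. - g (- x))"
  unfolding is_primitive_def
proof (intro conjI allI impI)
  note g = is_primitiveD(1)[OF assms]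
  have "(\<lambda>x. f (- x)) integrable_on {a..b} \<longleftrightarrow> f integrable_on {-b..-a}" for f :: "real \<Rightarrow> real" and a b
    using Henstock_Kurzweil_Integration.integrable_reflect_real[where f = f and a = "-b" and b = "-a"] by simp
  from this[of g] this[of "\<lambda>x. \<bar>g x\<bar>"]
  have "(\<lambda>x. g (- x)) absolutely_integrable_on {a..b}" for a b
    using locally_integrableD(2,3)[OF g] by (simp add: absolutely_integrable_on_def)
  then show "locally_integrable (\<lambda>x. - g (- x))"
    using locally_integrable_cmult[of "\<lambda>x. g (- x)" "-1"] by (simp add: locally_integrable_def)
  fix a b :: real assume "a \<le> b"
  then show "u (- b) - u (- a) = integral {a..b} (\<lambda>x. - g (- x))"
    using is_primitiveD(2)[OF assms, of "-b" "-a"] Henstock_Kurzweil_Integration.integral_reflect_real[of "-a" "-b" g]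
    by (simp add: algebra_simps)
qed

text \<open>
  The Lebesgue differentiation theorem, along the increments \<open>1 / (n + 1)\<close>.  It yields both the
  uniqueness of densities and the pointwise limit needed for Fatou's lemma.
\<close>

lemma AE_difference_quotient_tendsto:
  assumes "is_primitive u g"
  shows "AE x in lebesgue. (\<lambda>n. real (Suc n) * (u (x + 1 / real (Suc n)) - u x)) \<longlonglongrightarrow> g x"
proof -
  have "\<And>a b. g integrable_on cbox a b"
    using locally_integrableD(2)[OF is_primitiveD(1)[OF assms]] by simp
  from integrable_ccontinuous_explicit[OF this] obtain N where N: "negligible N"
    "\<And>x e. \<lbrakk>x \<notin> N; 0 < e\<rbrakk> \<Longrightarrow>
       \<exists>d>0. \<forall>h. 0 < h \<and> h < d \<longrightarrow> norm (integral (cbox x (x + h *\<^sub>R One)) g /\<^sub>R h ^ DIM(real) - g x) < e"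
    by metis
  have "(\<lambda>n. real (Suc n) * (u (x + 1 / real (Suc n)) - u x)) \<longlonglongrightarrow> g x" if xN: "x \<notin> N" for x
  proof (rule metric_LIMSEQ_I)
    fix e :: real assume "e > 0"
    then obtain d where d: "d > 0" "\<And>h. 0 < h \<Longrightarrow> h < d \<Longrightarrow> \<bar>integral {x..x + h} g / h - g x\<bar> < e"
      using N(2)[OF xN \<open>e > 0\<close>] by (auto simp: divide_inverse mult.commute)
    obtain n0 where n0: "inverse (real (Suc n0)) < d" using reals_Archimedean[OF d(1)] by blast
    show "\<exists>no. \<forall>n\<ge>no. dist (real (Suc n) * (u (x + 1 / real (Suc n)) - u x)) (g x) < e"
    proof (intro exI allI impI)
      fix n assume "n \<ge> n0"
      then have "1 / real (Suc n) < d" using n0 by (smt (verit) Suc_le_mono frac_le inverse_eq_divide of_nat_0_less_iff of_nat_mono zero_less_Suc)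
      from d(2)[OF _ this] is_primitiveD(2)[OF assms, of x "x + 1 / real (Suc n)"]
      show "dist (real (Suc n) * (u (x + 1 / real (Suc n)) - u x)) (g x) < e"
        by (simp add: dist_real_def mult.commute del: of_nat_Suc)
    qed
  qed
  then have "{x. \<not> (\<lambda>n. real (Suc n) * (u (x + 1 / real (Suc n)) - u x)) \<longlonglongrightarrow> g x} \<subseteq> N" by blast
  moreover have "N \<in> null_sets lebesgue" using N(1) by (simp add: negligible_iff_null_sets)
  ultimately show ?thesis by (intro AE_I'[of N]) auto
qed

lemma is_primitive_AE_unique:
  assumes "is_primitive u g" "is_primitive u h"
  shows "AE x in lebesgue. g x = h x"
  using AE_difference_quotient_tendsto[OF assms(1)] AE_difference_quotient_tendsto[OF assms(2)]
  by eventually_elim (rule LIMSEQ_unique)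

lemma locally_integrable_measurable:
  assumes "locally_integrable g"
  shows "g \<in> borel_measurable lebesgue"
proof (rule borel_measurable_LIMSEQ_real)
  show "(\<lambda>x. indicator {- real n..real n} x *\<^sub>R g x) \<in> borel_measurable lebesgue" for n
    using locally_integrableD(1)[OF assms] unfolding set_integrable_def by (rule borel_measurable_integrable)
  show "(\<lambda>n. indicator {- real n..real n} x *\<^sub>R g x) \<longlonglongrightarrow> g x" for x
  proof (rule tendsto_eventually)
    obtain n0 :: nat where n0: "\<bar>x\<bar> \<le> real n0" using real_arch_simple by blast
    show "\<forall>\<^sub>F n in sequentially. indicator {- real n..real n} x *\<^sub>R g x = g x"
      using eventually_ge_at_top[of n0] by eventually_elim (use n0 in \<open>auto simp: indicator_def\<close>)
  qed
qed

lemma LINT_eq_integral_Icc: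
  assumes "locally_integrable f" "\<And>x. x \<notin> {a..b} \<Longrightarrow> f x = 0"
  shows "integrable lebesgue f" "(LINT x|lebesgue. f x) = integral {a..b} f"
proof -
  have "(\<lambda>x. indicator {a..b} x *\<^sub>R f x) = f" using assms(2) by (auto simp: indicator_def fun_eq_iff)
  with locally_integrableD(1)[OF assms(1), of a b] set_lebesgue_integral_eq_integral(2)[of "{a..b}" f]
  show "integrable lebesgue f" "(LINT x|lebesgue. f x) = integral {a..b} f"
    by (simp_all add: set_integrable_def set_lebesgue_integral_def)
qed

lemma compactly_supported_radius:
  assumes "compactly_supported u"
  obtains R :: real where "R > 0" "\<And>x. \<bar>x\<bar> \<ge> R \<Longrightarrow> u x = 0"
proof -
  have "bounded (closure {x. u x \<noteq> 0})"
    using assms unfolding compactly_supported_def by (rule compact_imp_bounded)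
  then obtain R where R: "R > 0" "\<forall>x\<in>closure {x. u x \<noteq> 0}. \<bar>x\<bar> \<le> R"
    unfolding bounded_pos real_norm_def by blast
  show ?thesis
  proof (rule that[of "R + 1"])
    show "u x = 0" if "\<bar>x\<bar> \<ge> R + 1" for x
      using R(2) that closure_subset[of "{x. u x \<noteq> 0}"] by force
  qed (use R(1) in simp)
qed

section \<open>Weak derivatives of continuous functions\<close>

definition times_differentiable :: "nat \<Rightarrow> (real \<Rightarrow> real) \<Rightarrow> bool" where
  "times_differentiable n f \<longleftrightarrow> (\<forall>k\<le>n. (deriv ^^ k) f differentiable_on UNIV)"

lemma times_differentiable_0: "times_differentiable 0 f \<longleftrightarrow> f differentiable_on UNIV"
  by (simp add: times_differentiable_def)

lemma times_differentiable_Suc: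
  "times_differentiable (Suc n) f \<longleftrightarrow> f differentiable_on UNIV \<and> times_differentiable n (deriv f)"
proof -
  have "(\<forall>k\<le>Suc n. (deriv ^^ k) f differentiable_on UNIV) \<longleftrightarrow>
      (deriv ^^ 0) f differentiable_on UNIV \<and> (\<forall>k\<le>n. (deriv ^^ Suc k) f differentiable_on UNIV)"
    by (metis Suc_le_mono le0 not0_implies_Suc)
  then show ?thesis
    unfolding times_differentiable_def by (simp add: funpow_Suc_right del: funpow.simps(2)) 
qed

lemma times_differentiable_imp_diff:
  "times_differentiable n f \<Longrightarrow> f differentiable_on UNIV"
  unfolding times_differentiable_def by (elim allE[of _ 0]) simp

lemma times_differentiable_pred:
  "times_differentiable (Suc n) f \<Longrightarrow> times_differentiable n f"
  by (simp add: times_differentiable_def)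

lemma DERIV_of_differentiable_on_UNIV:
  fixes f :: "real \<Rightarrow> real"
  assumes "f differentiable_on UNIV"
  shows "(f has_real_derivative deriv f x) (at x)"
  using assms DERIV_deriv_iff_real_differentiable
  by (auto simp: differentiable_on_def)

lemma differentiable_on_UNIV_DERIV:
  fixes f :: "real \<Rightarrow> real"
  assumes "\<And>x. (f has_real_derivative f' x) (at x)"
  shows "f differentiable_on UNIV" "deriv f = f'"
proof -
  show "f differentiable_on UNIV"
    using assms by (auto simp: differentiable_on_def real_differentiable_def)
  show "deriv f = f'" using assms DERIV_imp_deriv by blast
qed

lemma times_differentiable_SucI:
  assumes "\<And>x. (f has_real_derivative f' x) (at x)" "times_differentiable n f'"
  shows "times_differentiable (Suc n) f"
  using differentiable_on_UNIV_DERIV[of f f', OF assms(1)] assms(2)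
  by (simp add: times_differentiable_Suc)

lemma times_differentiable_affine:
  assumes "times_differentiable n f"
  shows "times_differentiable n (\<lambda>x. c * f (m * x + b) + d)"
  using assms
proof (induction n arbitrary: f c d)
  case 0
  then have "(f has_real_derivative deriv f x) (at x)" for x
    by (intro DERIV_of_differentiable_on_UNIV) (simp add: times_differentiable_0)
  then have "((\<lambda>x. c * f (m * x + b) + d) has_real_derivative c * (deriv f (m * x + b) * m)) (at x)" for x
    by (auto intro!: derivative_eq_intros DERIV_chain2[where f = f])
  then show ?case
    unfolding times_differentiable_0 by (rule differentiable_on_UNIV_DERIV(1))
next
  case (Suc n)
  have f: "(f has_real_derivative deriv f x) (at x)" for x
    using Suc.prems by (intro DERIV_of_differentiable_on_UNIV times_differentiable_imp_diff)
  have "((\<lambda>x. c * f (m * x + b) + d) has_real_derivative (c * m) * deriv f (m * x + b) + 0) (at x)" for x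
    by (auto intro!: derivative_eq_intros DERIV_chain2[where f = f] f)
  moreover have "times_differentiable n (\<lambda>x. (c * m) * deriv f (m * x + b) + 0)"
    using Suc.prems by (intro Suc.IH) (simp add: times_differentiable_Suc)
  ultimately show ?case by (rule times_differentiable_SucI)
qed

lemma times_differentiable_add:
  assumes "times_differentiable n f" "times_differentiable n g"
  shows "times_differentiable n (\<lambda>x. f x + g x)"
  using assms
proof (induction n arbitrary: f g)
  case 0
  then show ?case by (auto simp: times_differentiable_0)
next
  case (Suc n)
  have "(f has_real_derivative deriv f x) (at x)" "(g has_real_derivative deriv g x) (at x)" for x
    using Suc.prems by (auto intro: DERIV_of_differentiable_on_UNIV times_differentiable_imp_diff)
  then have "((\<lambda>x. f x + g x) has_real_derivative deriv f x + deriv g x) (at x)" for x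
    by (rule DERIV_add)
  moreover have "times_differentiable n (\<lambda>x. deriv f x + deriv g x)"
    using Suc.prems by (intro Suc.IH) (auto simp: times_differentiable_Suc)
  ultimately show ?case by (rule times_differentiable_SucI)
qed

lemma times_differentiable_mult:
  assumes "times_differentiable n f" "times_differentiable n g"
  shows "times_differentiable n (\<lambda>x. f x * g x)"
  using assms
proof (induction n arbitrary: f g)
  case 0
  then show ?case by (auto simp: times_differentiable_0)
next
  case (Suc n)
  have "(f has_real_derivative deriv f x) (at x)" "(g has_real_derivative deriv g x) (at x)" for x
    using Suc.prems by (auto intro: DERIV_of_differentiable_on_UNIV times_differentiable_imp_diff)
  then have "((\<lambda>x. f x * g x) has_real_derivative deriv f x * g x + deriv g x * f x) (at x)" for x
    by (rule DERIV_mult)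
  moreover have "times_differentiable n (\<lambda>x. deriv f x * g x + deriv g x * f x)"
    using Suc.prems
    by (intro times_differentiable_add Suc.IH) (auto simp: times_differentiable_Suc intro: times_differentiable_pred)
  ultimately show ?case by (rule times_differentiable_SucI)
qed

text \<open>
  The family is closed under differentiation up to linear combinations, which makes the
  smoothness of \<open>exp (-1/x)\<close> at the origin a plain induction.
\<close>

definition flat_exp :: "nat \<Rightarrow> real \<Rightarrow> real" where
  "flat_exp k x = (if x > 0 then exp (- (1 / x)) * (1 / x) ^ k else 0)"

lemma flat_exp_tendsto_0: "(flat_exp k \<longlongrightarrow> 0) (at 0)"
proof (rule filterlim_split_at)
  show "(flat_exp k \<longlongrightarrow> 0) (at_left 0)"
    by (rule tendsto_eventually) (auto simp: flat_exp_def eventually_at_filter)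
  have "((\<lambda>x. (1/x) ^ k / exp (1/x)) \<longlongrightarrow> (0::real)) (at_right 0)"
    using filterlim_compose[OF tendsto_power_div_exp_0 filterlim_inverse_at_top_right]
    by (simp add: inverse_eq_divide)
  moreover have "\<forall>\<^sub>F x in at_right 0. (1/x) ^ k / exp (1/x) = flat_exp k x"
    by (auto simp: flat_exp_def eventually_at_filter exp_minus field_simps)
  ultimately show "(flat_exp k \<longlongrightarrow> 0) (at_right 0)"
    by (rule Lim_transform_eventually)
qed

lemma flat_exp_DERIV:
  "(flat_exp k has_real_derivative flat_exp (k + 2) x + (- real k * flat_exp (k + 1) (1 * x + 0) + 0)) (at x)"
proof -
  consider "x > 0" | "x < 0" | "x = 0" by linarith
  then show ?thesis
  proof cases
    case 1
    have "((\<lambda>x. exp (- (1 / x)) * (1 / x) ^ k) has_real_derivative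
        flat_exp (k + 2) x + (- real k * flat_exp (k + 1) x)) (at x)"
    proof -
      have i: "((\<lambda>x. 1 / x) has_real_derivative - ((1/x)^2)) (at x)"
        using 1 by (auto intro!: derivative_eq_intros simp: power2_eq_square)
      have "((\<lambda>x. exp (- (1 / x)) * (1 / x) ^ k) has_real_derivative
        exp (- (1/x)) * (1/x)^2 * (1/x)^k + real k * (- ((1/x)^2) * (1/x)^(k - 1)) * exp (- (1/x))) (at x)"
        by (rule derivative_eq_intros i refl | simp)+
      moreover have "E * q\<^sup>2 * q ^ k + real k * (- (q\<^sup>2) * q ^ (k - 1)) * E
          = E * q ^ (k + 2) + - real k * (E * q ^ (k + 1))" for E q :: real
        by (cases k) (auto simp: power2_eq_square algebra_simps)
      ultimately show ?thesis using 1 by (simp only: flat_exp_def if_True)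
    qed
    moreover have "\<forall>\<^sub>F y in nhds x. y \<in> {0<..}" using 1 by (intro eventually_nhds_in_open) auto
    then have "\<forall>\<^sub>F y in nhds x. flat_exp k y = exp (- (1 / y)) * (1 / y) ^ k"
      by eventually_elim (simp add: flat_exp_def)
    ultimately show ?thesis
      using DERIV_cong_ev[OF refl, of "flat_exp k" "\<lambda>y. exp (- (1 / y)) * (1 / y) ^ k" x] by simp
  next
    case 2
    have "\<forall>\<^sub>F y in nhds x. y \<in> {..<0}" using 2 by (intro eventually_nhds_in_open) auto
    then have "\<forall>\<^sub>F y in nhds x. flat_exp k y = 0" by eventually_elim (simp add: flat_exp_def)
    moreover have "((\<lambda>y. 0) has_real_derivative 0) (at x)" by simp
    ultimately show ?thesis
      using 2 DERIV_cong_ev[OF refl, of "flat_exp k" "\<lambda>y. 0" x 0] by (simp add: flat_exp_def)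
  next
    case 3
    have "((\<lambda>h. (flat_exp k (0 + h) - flat_exp k 0) / h) \<longlongrightarrow> 0) (at 0)"
    proof (rule Lim_transform_eventually[OF flat_exp_tendsto_0[of "Suc k"]])
      show "\<forall>\<^sub>F h in at 0. flat_exp (Suc k) h = (flat_exp k (0 + h) - flat_exp k 0) / h"
        by (rule always_eventually) (auto simp: flat_exp_def)
    qed
    then show ?thesis using 3 by (simp add: DERIV_def flat_exp_def)
  qed
qed

lemma flat_exp_smooth: "times_differentiable n (flat_exp k)"
proof (induction n arbitrary: k)
  case 0
  show ?case
    unfolding times_differentiable_0 by (rule differentiable_on_UNIV_DERIV(1)[OF flat_exp_DERIV])
next
  case (Suc n)
  show ?case
    by (rule times_differentiable_SucI[OF flat_exp_DERIV])
      (intro times_differentiable_add times_differentiable_affine Suc.IH)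
qed


lemma is_primitive_of_DERIV:
  assumes "\<And>x. (f has_real_derivative f' x) (at x)" "continuous_on UNIV f'"
  shows "is_primitive f f'"
  unfolding is_primitive_def
proof (intro conjI allI impI locally_integrable_continuous assms)
  fix a b :: real assume "a \<le> b"
  then have "(f' has_integral (f b - f a)) {a..b}"
    by (intro fundamental_theorem_of_calculus)
      (auto simp flip: has_real_derivative_iff_has_vector_derivative
        intro: DERIV_subset[OF assms(1)])
  then show "f b - f a = integral {a..b} f'" by (simp add: integral_unique)
qed

text \<open>
  The product \<open>exp (-1/x) * exp (-1/(1-x))\<close>, extended by zero, is a smooth bump on the unit interval; its
  normalised antiderivative is a smooth transition from \<open>0\<close> to \<open>1\<close>.
\<close>

lemma smooth_step_exists:
  obtains S \<beta> :: "real \<Rightarrow> real"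
  where "\<And>x. (S has_real_derivative \<beta> x) (at x)" "continuous_on UNIV \<beta>"
    "\<And>x. \<beta> x \<ge> 0" "\<And>x. x \<notin> {0..1} \<Longrightarrow> \<beta> x = 0"
    "\<And>x. x \<le> 0 \<Longrightarrow> S x = 0" "\<And>x. x \<ge> 1 \<Longrightarrow> S x = 1" "\<And>x. 0 \<le> S x \<and> S x \<le> 1"
    "\<And>n. times_differentiable n S"
proof -
  (* The neutral terms give the second factor the shape required by times_differentiable_affine. *)
  define b where "b x = flat_exp 0 x * (1 * flat_exp 0 ((-1) * x + 1) + 0)" for x
  have b_smooth: "times_differentiable n b" for n
    unfolding b_def by (intro times_differentiable_mult times_differentiable_affine flat_exp_smooth)
  have b_cont: "continuous_on S b" for S
    using times_differentiable_imp_diff[OF b_smooth[of 0]]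
    by (meson continuous_on_subset differentiable_imp_continuous_on subset_UNIV)
  have b_nonneg: "b x \<ge> 0" for x by (simp add: b_def flat_exp_def)
  have b_out: "b x = 0" if "x \<notin> {0<..<1}" for x using that by (auto simp: b_def flat_exp_def)
  have b_pos: "b (1/2) > 0" by (simp add: b_def flat_exp_def)
  obtain B where B: "\<And>x. (B has_real_derivative b x) (at x)"
  proof -
    have "\<exists>F. \<forall>x::real. - \<infinity> < ereal x \<longrightarrow> ereal x < \<infinity> \<longrightarrow> (F has_vector_derivative b x) (at x)"
      using b_cont[of UNIV] by (intro einterval_antiderivative) (auto simp: continuous_on_eq_continuous_at)
    then show ?thesis using that by (auto simp: has_real_derivative_iff_has_vector_derivative)
  qed
  have mono: "B x \<le> B y" if "x \<le> y" for x y
    by (rule DERIV_nonneg_imp_nondecreasing[OF that]) (use B b_nonneg in blast)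
  have left: "B x = B 0" if "x \<le> 0" for x
  proof (cases "x = 0")
    case False
    with that have "x < 0" by simp
    from MVT2[OF this, of B b] B obtain z where "x < z" "z < 0" "B 0 - B x = (0 - x) * b z" by blast
    then show ?thesis using b_out[of z] by simp
  qed simp
  have right: "B x = B 1" if "x \<ge> 1" for x
  proof (cases "x = 1")
    case False
    with that have "1 < x" by simp
    from MVT2[OF this, of B b] B obtain z where "1 < z" "z < x" "B x - B 1 = (x - 1) * b z" by blast
    then show ?thesis using b_out[of z] by simp
  qed simp
  have "B 0 \<noteq> B 1"
  proof
    assume eq: "B 0 = B 1"
    have "b (1/2) = 0"
    proof (rule DERIV_local_const[OF B, of "1/2" "1/2"])
      show "\<forall>y. \<bar>1/2 - y\<bar> < 1/2 \<longrightarrow> B (1/2) = B y"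
      proof (intro allI impI)
        fix y :: real assume "\<bar>1/2 - y\<bar> < 1/2"
        then have "0 \<le> y" "y \<le> 1" by (auto simp: abs_if split: if_splits)
        then show "B (1/2) = B y"
          using mono[of 0 y] mono[of y 1] mono[of 0 "1/2"] mono[of "1/2" 1] eq by simp
      qed
    qed simp
    then show False using b_pos by simp
  qed
  with mono[of 0 1] have gt: "B 1 - B 0 > 0" by simp
  define c where "c = 1 / (B 1 - B 0)"
  have c: "c > 0" "c * (B 1 - B 0) = 1" using gt by (auto simp: c_def)
  define S where "S x = c * (B x - B 0)" for x
  show ?thesis
  proof (rule that[of S "\<lambda>x. c * b (1 * x + 0) + 0"])
    show S': "(S has_real_derivative c * b (1 * x + 0) + 0) (at x)" for x
      unfolding S_def by (auto intro!: derivative_eq_intros B)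
    show "continuous_on UNIV (\<lambda>x. c * b (1 * x + 0) + 0)" by (simp add: continuous_on_mult_left b_cont)
    show "c * b (1 * x + 0) + 0 \<ge> 0" for x using c b_nonneg by simp
    show "c * b (1 * x + 0) + 0 = 0" if "x \<notin> {0..1}" for x using that b_out[of x] by auto
    show S0: "S x = 0" if "x \<le> 0" for x using left[OF that] by (simp add: S_def)
    show S1: "S x = 1" if "x \<ge> 1" for x using right[OF that] c(2) by (simp add: S_def)
    have "S x \<le> S y" if "x \<le> y" for x y
      unfolding S_def using mono[OF that] c(1) by (intro mult_left_mono) auto
    then show "0 \<le> S x \<and> S x \<le> 1" for x
      using S0[of 0] S1[of 1] S0[of x] S1[of x]
      by (metis linear order_refl)
    show "times_differentiable n S" for n
    proof (cases n)
      case 0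
      show ?thesis unfolding 0 times_differentiable_0 by (rule differentiable_on_UNIV_DERIV(1)[OF S'])
    next
      case (Suc m)
      show ?thesis unfolding Suc
        by (rule times_differentiable_SucI[OF S']) (intro times_differentiable_affine b_smooth)
    qed
  qed
qed

lemma is_primitive_imp_weak_derivative:
  assumes u: "is_primitive u g"
  shows "has_weak_derivative u g"
  unfolding has_weak_derivative_def
proof (intro conjI allI impI)
  note g = is_primitiveD(1)[OF u] and cont = is_primitive_continuous[OF u]
  show "locally_integrable g" by (rule g)
  show "locally_integrable u" by (rule locally_integrable_continuous[OF cont])
  fix \<phi> assume "test_function \<phi>"
  then have diff: "\<And>n. (deriv ^^ n) \<phi> differentiable_on UNIV" and supp: "compactly_supported \<phi>"
    by (auto simp: test_function_def)
  have \<phi>': "(\<phi> has_real_derivative deriv \<phi> x) (at x)" for x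
    using diff[of 0] by (simp add: DERIV_of_differentiable_on_UNIV)
  have \<phi>'_cont: "continuous_on UNIV (deriv \<phi>)"
    using diff[of 1] by (simp add: differentiable_imp_continuous_on)
  have \<phi>: "is_primitive \<phi> (deriv \<phi>)" by (rule is_primitive_of_DERIV[OF \<phi>' \<phi>'_cont])
  obtain R where R: "R > 0" "\<And>x. \<bar>x\<bar> \<ge> R \<Longrightarrow> \<phi> x = 0"
    using compactly_supported_radius[OF supp] by blast
  have out: "\<phi> x = 0" "deriv \<phi> x = 0" if "x \<notin> {-R-1..R+1}" for x
  proof -
    have x: "\<bar>x\<bar> > R" using that by auto
    then show "\<phi> x = 0" using R(2) by simp
    show "deriv \<phi> x = 0"
    proof (rule DERIV_local_const[OF \<phi>', of "\<bar>x\<bar> - R"])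
      show "\<forall>y. \<bar>x - y\<bar> < \<bar>x\<bar> - R \<longrightarrow> \<phi> x = \<phi> y"
        using R(2) x by (smt (verit))
    qed (use x in simp)
  qed
  have l1: "locally_integrable (\<lambda>x. u x * deriv \<phi> x)"
    by (intro locally_integrable_continuous continuous_intros cont \<phi>'_cont)
  have l2: "locally_integrable (\<lambda>x. \<phi> x * g x)"
    by (rule locally_integrable_times_continuous[OF g is_primitive_continuous[OF \<phi>]])
  have "integral {-R-1..R+1} (\<lambda>x. u x * deriv \<phi> x + \<phi> x * g x) = 0"
    using is_primitiveD(2)[OF is_primitive_times[OF u \<phi>], of "-R-1" "R+1"] R by simp
  then have "integral {-R-1..R+1} (\<lambda>x. u x * deriv \<phi> x) + integral {-R-1..R+1} (\<lambda>x. \<phi> x * g x) = 0"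
    using locally_integrableD(2)[OF l1] locally_integrableD(2)[OF l2] by (simp add: integral_add)
  then show "(LINT x|lebesgue. u x * deriv \<phi> x) = - (LINT x|lebesgue. g x * \<phi> x)"
    using LINT_eq_integral_Icc(2)[OF l1, of "-R-1" "R+1"] LINT_eq_integral_Icc(2)[OF l2, of "-R-1" "R+1"] out
    by (simp add: mult.commute)
qed

text \<open>
  Testing with a smooth bump that is \<open>0\<close> up to \<open>a\<close>, climbs to \<open>1\<close> within distance \<open>1/(n+1)\<close>, and
  descends again just after \<open>b\<close>: its derivative concentrates at \<open>a\<close> and \<open>b\<close>, the bump itself tends
  to the indicator of the interval.
\<close>

lemma weak_derivative_imp_is_primitive:
  assumes cont: "continuous_on UNIV u" and wd: "has_weak_derivative u g"
  shows "is_primitive u g"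
  unfolding is_primitive_def
proof (intro conjI allI impI)
  show g: "locally_integrable g" using wd by (simp add: has_weak_derivative_def)
  fix a b :: real assume ab: "a \<le> b"
  obtain S \<beta> :: "real \<Rightarrow> real"
  where S': "\<And>x. (S has_real_derivative \<beta> x) (at x)" and \<beta>_cont: "continuous_on UNIV \<beta>"
    and \<beta>_nonneg: "\<And>x. \<beta> x \<ge> 0" and \<beta>_out: "\<And>x. x \<notin> {0..1} \<Longrightarrow> \<beta> x = 0"
    and S0: "\<And>x. x \<le> 0 \<Longrightarrow> S x = 0" and S1: "\<And>x. x \<ge> 1 \<Longrightarrow> S x = 1"
    and S01: "\<And>x. 0 \<le> S x \<and> S x \<le> 1" and S_smooth: "\<And>n. times_differentiable n S"
    by (rule smooth_step_exists) (rule that; assumption)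
  define m where "m n = real (Suc n)" for n
  have m: "m n \<ge> 1" for n by (simp add: m_def)
  (* Each summand has the literal shape of an affine substitution, for times_differentiable_affine. *)
  define \<phi> where "\<phi> n x = (1 * S (m n * x + (- m n * a)) + 0) + ((-1) * S (m n * x + (- m n * b)) + 0)" for n x
  define \<psi> where "\<psi> c n x = m n * \<beta> (m n * (x - c))" for c n x
  have \<phi>': "(\<phi> n has_real_derivative \<psi> a n x - \<psi> b n x) (at x)" for n x
    unfolding \<phi>_def \<psi>_def
    by (auto intro!: derivative_eq_intros DERIV_chain2[where f = S] S' simp: algebra_simps)
  have \<phi>_01: "\<bar>\<phi> n x\<bar> \<le> 1" for n x
    using S01[of "m n * x + (- m n * a)"] S01[of "m n * x + (- m n * b)"]
    unfolding \<phi>_def by linarith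
  have \<phi>_out: "\<phi> n x = 0" if "x \<notin> {a..b+1}" for n x
  proof (cases "x < a")
    case True
    then have "m n * x \<le> m n * a" "m n * x \<le> m n * b"
      using m[of n] ab by (auto intro!: mult_left_mono)
    then show ?thesis using S0 by (simp add: \<phi>_def)
  next
    case False
    with that have "x - b \<ge> 1" "x - a \<ge> 1" using ab by auto
    then have "m n * (x - b) \<ge> 1 * 1" "m n * (x - a) \<ge> 1 * 1" using m[of n] by (intro mult_mono; simp)+
    then show ?thesis using S1 by (simp add: \<phi>_def algebra_simps)
  qed
  have test: "test_function (\<phi> n)" for n
    unfolding test_function_def
  proof (intro conjI allI)
    fix k
    have "times_differentiable k (\<phi> n)"
      unfolding \<phi>_def by (intro times_differentiable_add times_differentiable_affine S_smooth)
    then show "(deriv ^^ k) (\<phi> n) differentiable_on UNIV" by (simp add: times_differentiable_def)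
    have "{x. \<phi> n x \<noteq> 0} \<subseteq> {a..b+1}" using \<phi>_out by blast
    then have "closure {x. \<phi> n x \<noteq> 0} \<subseteq> {a..b+1}" by (simp add: closure_minimal)
    then show "compactly_supported (\<phi> n)"
      unfolding compactly_supported_def by (meson bounded_closed_interval bounded_subset closed_closure compact_eq_bounded_closed)
  qed
  have \<psi>_int: "integrable lborel (\<lambda>x. u x * \<psi> c n x)"
    and \<psi>_eq: "(LINT x|lborel. u x * \<psi> c n x) = (LINT s|lborel. u (c + s / m n) * \<beta> s)" for c n
  proof -
    have cc: "continuous_on UNIV (\<lambda>s. u (c + s / m n) * \<beta> s)"
      using m[of n] by (intro continuous_intros continuous_on_compose2[OF cont] \<beta>_cont) auto
    have "integrable lborel (\<lambda>s. indicator {0..1} s *\<^sub>R (u (c + s / m n) * \<beta> s))"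
      by (intro borel_integrable_compact continuous_on_subset[OF cc]) auto
    also have "(\<lambda>s. indicator {0..1} s *\<^sub>R (u (c + s / m n) * \<beta> s)) = (\<lambda>s. u (c + s / m n) * \<beta> s)"
      using \<beta>_out by (auto simp: indicator_def fun_eq_iff)
    finally have i: "integrable lborel (\<lambda>s. u (c + s / m n) * \<beta> s)" .
    have eq: "(\<lambda>s. u (c + s / m n) * \<beta> s) = (\<lambda>s. (1 / m n) * (u (c + (1 / m n) * s) * \<psi> c n (c + (1 / m n) * s)))"
      using m[of n] by (auto simp: \<psi>_def fun_eq_iff)
    have mn: "1 / m n \<noteq> 0" using m[of n] by simp
    have "integrable lborel (\<lambda>s. m n * (u (c + s / m n) * \<beta> s))" using i by simp
    also have "(\<lambda>s. m n * (u (c + s / m n) * \<beta> s)) = (\<lambda>s. u (c + (1 / m n) * s) * \<psi> c n (c + (1 / m n) * s))"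
      using m[of n] by (auto simp: \<psi>_def fun_eq_iff)
    finally show "integrable lborel (\<lambda>x. u x * \<psi> c n x)"
      using lborel_integrable_real_affine_iff[OF mn, of "\<lambda>x. u x * \<psi> c n x" c] by simp
    show "(LINT x|lborel. u x * \<psi> c n x) = (LINT s|lborel. u (c + s / m n) * \<beta> s)"
      using lborel_integral_real_affine[OF mn, of "\<lambda>x. u x * \<psi> c n x" c] m[of n]
      by (subst eq) simp
  qed
  have \<beta>_int: "integrable lborel \<beta>"
    and \<beta>_1: "(LINT s|lborel. \<beta> s) = 1"
  proof -
    have h: "has_bochner_integral lborel (\<lambda>x. \<beta> x * indicator {0..1} x) (S 1 - S 0)"
      using \<beta>_cont
      by (intro has_bochner_integral_FTC_Icc_nonneg S' \<beta>_nonneg)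
        (auto intro: borel_measurable_continuous_onI)
    have e: "(\<lambda>x. \<beta> x * indicator {0..1} x) = \<beta>"
      using \<beta>_out by (auto simp: indicator_def fun_eq_iff)
    show "integrable lborel \<beta>" "(LINT s|lborel. \<beta> s) = 1"
      using h S0[of 0] S1[of 1] unfolding e by (auto simp: has_bochner_integral_iff)
  qed
  have conc: "(\<lambda>n. LINT x|lborel. u x * \<psi> c n x) \<longlonglongrightarrow> u c" for c
  proof -
    have "bounded (u ` {c..c+1})"
      by (intro compact_imp_bounded compact_continuous_image continuous_on_subset[OF cont]) auto
    then have "\<exists>C. \<forall>x\<in>{c..c+1}. \<bar>u x\<bar> \<le> C" by (simp add: bounded_iff)
    then obtain C where C: "\<And>x. x \<in> {c..c+1} \<Longrightarrow> \<bar>u x\<bar> \<le> C" by blast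
    have "(\<lambda>n. LINT s|lborel. u (c + s / m n) * \<beta> s) \<longlonglongrightarrow> (LINT s|lborel. u c * \<beta> s)"
    proof (rule integral_dominated_convergence[where w = "\<lambda>s. C * \<beta> s"])
      have [measurable]: "u \<in> borel_measurable borel" "\<beta> \<in> borel_measurable borel"
        using cont \<beta>_cont by (auto intro: borel_measurable_continuous_onI)
      show "(\<lambda>s. u c * \<beta> s) \<in> borel_measurable lborel" "(\<lambda>s. u (c + s / m n) * \<beta> s) \<in> borel_measurable lborel" for n
        by measurable
      show "integrable lborel (\<lambda>s. C * \<beta> s)" using \<beta>_int by simp
      have "(\<lambda>n. c + s / m n) \<longlonglongrightarrow> c + s * 0" for s
        unfolding m_def divide_inverse by (intro tendsto_intros LIMSEQ_inverse_real_of_nat)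
      moreover have "isCont u c" using cont by (simp add: continuous_on_eq_continuous_at)
      ultimately have "(\<lambda>n. u (c + s / m n)) \<longlonglongrightarrow> u c" for s
        using isCont_tendsto_compose[of c u "\<lambda>n. c + s / m n"] by simp
      then show "AE s in lborel. (\<lambda>n. u (c + s / m n) * \<beta> s) \<longlonglongrightarrow> u c * \<beta> s"
        by (intro AE_I2 tendsto_mult tendsto_const)
      show "AE s in lborel. norm (u (c + s / m n) * \<beta> s) \<le> C * \<beta> s" for n
      proof (intro AE_I2)
        fix s
        show "norm (u (c + s / m n) * \<beta> s) \<le> C * \<beta> s"
        proof (cases "s \<in> {0..1}")
          case True
          then have "s / m n \<in> {0..1}" using m[of n] by (auto simp: field_simps)
          then have "\<bar>u (c + s / m n)\<bar> \<le> C" by (intro C) auto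
          from mult_right_mono[OF this \<beta>_nonneg[of s]] \<beta>_nonneg[of s]
          show ?thesis by (simp add: abs_mult)
        qed (simp add: \<beta>_out)
      qed
    qed
    then show ?thesis using \<beta>_1 by (simp add: \<psi>_eq)
  qed
  have lhs: "(LINT x|lebesgue. u x * deriv (\<phi> n) x) = (LINT x|lborel. u x * \<psi> a n x) - (LINT x|lborel. u x * \<psi> b n x)" for n
  proof -
    have "deriv (\<phi> n) = (\<lambda>x. \<psi> a n x - \<psi> b n x)" using differentiable_on_UNIV_DERIV(2)[OF \<phi>'] .
    then have "(LINT x|lebesgue. u x * deriv (\<phi> n) x) = (LINT x|lebesgue. u x * \<psi> a n x - u x * \<psi> b n x)"
      by (simp add: right_diff_distrib)
    also have "\<dots> = (LINT x|lborel. u x * \<psi> a n x - u x * \<psi> b n x)"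
      using \<psi>_int by (intro integral_completion borel_measurable_integrable Bochner_Integration.integrable_diff)
    also have "\<dots> = (LINT x|lborel. u x * \<psi> a n x) - (LINT x|lborel. u x * \<psi> b n x)"
      using \<psi>_int by (intro Bochner_Integration.integral_diff)
    finally show ?thesis .
  qed
  have \<phi>_lim: "(\<lambda>n. \<phi> n x) \<longlonglongrightarrow> indicator {a<..b} x" for x
  proof -
    have step: "(\<lambda>n. S (m n * x + (- m n * c))) \<longlonglongrightarrow> (if x > c then 1 else 0)" for c
    proof (rule tendsto_eventually)
      show "\<forall>\<^sub>F n in sequentially. S (m n * x + (- m n * c)) = (if x > c then 1 else 0)"
      proof (cases "x > c")
        case True
        then obtain n0 :: nat where n0: "1 / (x - c) \<le> real n0" using real_arch_simple by blast
        show ?thesis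
          using eventually_ge_at_top[of n0]
        proof eventually_elim
          case (elim n)
          then have "1 / (x - c) \<le> m n" using n0 by (simp add: m_def)
          then have "1 \<le> m n * (x - c)" using True by (simp add: field_simps)
          then show ?case using True S1 by (simp add: algebra_simps)
        qed
      next
        case False
        then have "m n * x \<le> m n * c" for n using m[of n] by (intro mult_left_mono) auto
        then show ?thesis using False S0 by simp
      qed
    qed
    have "(\<lambda>n. \<phi> n x) \<longlonglongrightarrow> (1 * (if x > a then 1 else 0) + 0) + ((-1) * (if x > b then 1 else 0) + 0)"
      unfolding \<phi>_def by (intro tendsto_intros step)
    also have "(1 * (if x > a then 1 else 0) + 0) + ((-1) * (if x > b then 1 else 0) + 0) = (indicator {a<..b} x :: real)"
      using ab by (auto simp: indicator_def)
    finally show ?thesis .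
  qed
  have "(\<lambda>n. LINT x|lebesgue. g x * \<phi> n x) \<longlonglongrightarrow> (LINT x|lebesgue. g x * indicator {a<..b} x)"
  proof (rule integral_dominated_convergence[where w = "\<lambda>x. indicator {a..b+1} x * \<bar>g x\<bar>"])
    have gm: "set_integrable lebesgue {c..d} g" for c d using locally_integrableD(1)[OF g] .
    show w: "integrable lebesgue (\<lambda>x. indicator {a..b+1} x * \<bar>g x\<bar>)"
      using set_integrable_abs[OF gm] by (simp add: set_integrable_def)
    have "set_integrable lebesgue {a<..b} g"
      by (rule set_integrable_subset[OF gm[of a b]]) auto
    then show "(\<lambda>x. g x * indicator {a<..b} x) \<in> borel_measurable lebesgue"
      unfolding set_integrable_def by (auto dest: borel_measurable_integrable simp: mult.commute)
    show "(\<lambda>x. g x * \<phi> n x) \<in> borel_measurable lebesgue" for n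
    proof -
      have "(\<lambda>x. (indicator {a..b+1} x *\<^sub>R g x) * \<phi> n x) \<in> borel_measurable lebesgue"
      proof (rule borel_measurable_times)
        show "(\<lambda>x. indicator {a..b+1} x *\<^sub>R g x) \<in> borel_measurable lebesgue"
          using gm unfolding set_integrable_def by (rule borel_measurable_integrable)
        have "continuous_on UNIV (\<phi> n)"
          using \<phi>' by (meson DERIV_isCont continuous_at_imp_continuous_on)
        then show "\<phi> n \<in> borel_measurable lebesgue"
          by (intro measurable_completion) (simp add: borel_measurable_continuous_onI)
      qed
      also have "(\<lambda>x. (indicator {a..b+1} x *\<^sub>R g x) * \<phi> n x) = (\<lambda>x. g x * \<phi> n x)"
        using \<phi>_out[of _ n] by (auto simp: indicator_def fun_eq_iff)
      finally show ?thesis .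
    qed
    show "AE x in lebesgue. (\<lambda>n. g x * \<phi> n x) \<longlonglongrightarrow> g x * indicator {a<..b} x"
      by (intro AE_I2 tendsto_mult tendsto_const \<phi>_lim)
    show "AE x in lebesgue. norm (g x * \<phi> n x) \<le> indicator {a..b+1} x * \<bar>g x\<bar>" for n
    proof (intro AE_I2)
      fix x
      show "norm (g x * \<phi> n x) \<le> indicator {a..b+1} x * \<bar>g x\<bar>"
        using mult_left_mono[OF \<phi>_01[of n x], of "\<bar>g x\<bar>"] \<phi>_out[of x n]
        by (cases "x \<in> {a..b+1}") (auto simp: abs_mult)
    qed
  qed
  moreover have "(LINT x|lebesgue. g x * indicator {a<..b} x) = integral {a..b} g"
  proof -
    have "set_integrable lebesgue {a<..b} g"
      by (rule set_integrable_subset[OF locally_integrableD(1)[OF g, of a b]]) auto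
    then have "(LINT x:{a<..b}|lebesgue. g x) = integral {a<..b} g"
      by (rule set_lebesgue_integral_eq_integral)
    also have "\<dots> = integral {a..b} g"
      by (rule integral_subset_negligible) (auto intro: negligible_subset[of "{a}"])
    finally show ?thesis by (simp add: set_lebesgue_integral_def mult.commute)
  qed
  moreover have "(LINT x|lebesgue. g x * \<phi> n x) = (LINT x|lborel. u x * \<psi> b n x) - (LINT x|lborel. u x * \<psi> a n x)" for n
    using wd test[of n] lhs[of n] unfolding has_weak_derivative_def by fastforce
  ultimately have "(\<lambda>n. (LINT x|lborel. u x * \<psi> b n x) - (LINT x|lborel. u x * \<psi> a n x)) \<longlonglongrightarrow> integral {a..b} g"
    by simp
  moreover have "(\<lambda>n. (LINT x|lborel. u x * \<psi> b n x) - (LINT x|lborel. u x * \<psi> a n x)) \<longlonglongrightarrow> u b - u a"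
    by (intro tendsto_diff conc)
  ultimately show "u b - u a = integral {a..b} g" by (rule LIMSEQ_unique[rotated])
qed

section \<open>Truncations\<close>

text \<open>
  The function \<open>(y + sqrt (y\<^sup>2 + \<epsilon>\<^sup>2)) / 2\<close> is a smooth approximation of the positive part whose
  derivative at \<open>0\<close> is \<open>1/2\<close>.  The arctangent term tends to \<open>0\<close> uniformly and lowers the
  derivative at \<open>0\<close> by exactly \<open>1/2\<close>, so that the limit density vanishes where \<open>u = 0\<close>.
  In this way, the fact that a density vanishes almost everywhere on level sets of positive
  measure is obtained along with the chain rule.
\<close>

lemma is_primitive_pos_part:
  assumes u: "is_primitive u g"
  shows "is_primitive (\<lambda>x. max (u x) 0) (\<lambda>x. (if u x > 0 then 1 else 0) * g x)"
proof -
  define \<epsilon> :: "nat \<Rightarrow> real" where "\<epsilon> n = inverse (real (Suc n))" for n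
  have e: "\<epsilon> n > 0" for n by (simp add: \<epsilon>_def)
  have elim: "\<epsilon> \<longlonglongrightarrow> 0" unfolding \<epsilon>_def by (rule LIMSEQ_inverse_real_of_nat)
  define F where "F n y = (y + sqrt (y\<^sup>2 + (\<epsilon> n)\<^sup>2)) / 2 - \<epsilon> n / 2 * arctan (y / \<epsilon> n)" for n y
  define f where "f n y = (1 + y / sqrt (y\<^sup>2 + (\<epsilon> n)\<^sup>2) - (\<epsilon> n)\<^sup>2 / ((\<epsilon> n)\<^sup>2 + y\<^sup>2)) / 2" for n y
  have pos: "y\<^sup>2 + (\<epsilon> n)\<^sup>2 > 0" for n y
    using e[of n] by (simp add: add_nonneg_pos)
  have F: "(F n has_real_derivative f n y) (at y)" for n y
  proof -
    have "((\<lambda>y. sqrt (y\<^sup>2 + (\<epsilon> n)\<^sup>2)) has_real_derivative y / sqrt (y\<^sup>2 + (\<epsilon> n)\<^sup>2)) (at y)"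
    proof -
      have D: "((\<lambda>y. y\<^sup>2 + (\<epsilon> n)\<^sup>2) has_real_derivative 2 * y) (at y)"
        by (auto intro!: derivative_eq_intros)
      moreover have "inverse r / 2 * (2 * y) = y / r" for r :: real
        by (simp add: field_simps)
      ultimately show ?thesis
        using DERIV_chain2[where g = "\<lambda>y. y\<^sup>2 + (\<epsilon> n)\<^sup>2", OF DERIV_real_sqrt[OF pos] D] by simp
    qed
    moreover have "((\<lambda>y. \<epsilon> n / 2 * arctan (y / \<epsilon> n)) has_real_derivative (\<epsilon> n)\<^sup>2 / ((\<epsilon> n)\<^sup>2 + y\<^sup>2) / 2) (at y)"
    proof -
      have "((\<lambda>y. y / \<epsilon> n) has_real_derivative 1 / \<epsilon> n) (at y)"
        by (rule DERIV_cdivide) (rule DERIV_ident)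
      from DERIV_cmult[OF DERIV_chain2[OF DERIV_arctan this], of "\<epsilon> n / 2"]
      have "((\<lambda>y. \<epsilon> n / 2 * arctan (y / \<epsilon> n)) has_real_derivative
          \<epsilon> n / 2 * (inverse (1 + (y / \<epsilon> n)\<^sup>2) * (1 / \<epsilon> n))) (at y)" .
      moreover have "1 + (y / \<epsilon> n)\<^sup>2 = ((\<epsilon> n)\<^sup>2 + y\<^sup>2) / (\<epsilon> n)\<^sup>2"
        using e[of n] by (simp add: field_simps)
      ultimately show ?thesis using e[of n] by (simp add: mult.commute)
    qed
    ultimately have "((\<lambda>y. (y + sqrt (y\<^sup>2 + (\<epsilon> n)\<^sup>2)) / 2 - \<epsilon> n / 2 * arctan (y / \<epsilon> n)) has_real_derivative
        (1 + y / sqrt (y\<^sup>2 + (\<epsilon> n)\<^sup>2)) / 2 - (\<epsilon> n)\<^sup>2 / ((\<epsilon> n)\<^sup>2 + y\<^sup>2) / 2) (at y)"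
      by (intro DERIV_diff DERIV_cdivide DERIV_add DERIV_ident)
    then show ?thesis
      unfolding F_def f_def by (simp add: diff_divide_distrib)
  qed
  have f: "continuous_on UNIV (f n)" for n
    unfolding f_def using pos[of _ n] by (intro continuous_intros) (auto simp: add.commute less_imp_neq[symmetric])
  have bd: "\<bar>f n y\<bar> \<le> 1" for n y
  proof -
    have "\<bar>y / sqrt (y\<^sup>2 + (\<epsilon> n)\<^sup>2)\<bar> \<le> 1"
      using pos[of y n] real_sqrt_le_mono[of "y\<^sup>2" "y\<^sup>2 + (\<epsilon> n)\<^sup>2"] by (simp add: field_simps)
    moreover have "0 \<le> (\<epsilon> n)\<^sup>2 / ((\<epsilon> n)\<^sup>2 + y\<^sup>2)" "(\<epsilon> n)\<^sup>2 / ((\<epsilon> n)\<^sup>2 + y\<^sup>2) \<le> 1"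
      using pos[of y n] by (auto simp: field_simps)
    moreover have "\<bar>(1 + a - b) / 2\<bar> \<le> 1" if "\<bar>a\<bar> \<le> 1" "0 \<le> b" "b \<le> 1" for a b :: real
      using that by (simp add: abs_le_iff)
    ultimately show ?thesis unfolding f_def by blast
  qed
  have flim: "(\<lambda>n. f n y) \<longlonglongrightarrow> (if y > 0 then 1 else 0)" for y
  proof (cases "y = 0")
    case True
    then have "f n y = 0" for n using e[of n] by (simp add: f_def)
    with True show ?thesis by simp
  next
    case False
    have "(\<lambda>n. f n y) \<longlonglongrightarrow> (1 + y / sqrt (y\<^sup>2 + 0\<^sup>2) - 0\<^sup>2 / (0\<^sup>2 + y\<^sup>2)) / 2"
      unfolding f_def by (intro tendsto_intros elim) (use False in auto)
    also have "(1 + y / sqrt (y\<^sup>2 + 0\<^sup>2) - 0\<^sup>2 / (0\<^sup>2 + y\<^sup>2)) / 2 = (if y > 0 then 1 else 0)"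
      using False by auto
    finally show ?thesis .
  qed
  have Flim: "(\<lambda>n. F n y) \<longlonglongrightarrow> max y 0" for y
  proof -
    have "(\<lambda>n. \<epsilon> n / 2 * arctan (y / \<epsilon> n)) \<longlonglongrightarrow> 0"
    proof (rule Lim_null_comparison)
      show "\<forall>\<^sub>F n in sequentially. norm (\<epsilon> n / 2 * arctan (y / \<epsilon> n)) \<le> \<epsilon> n * (pi / 4)"
      proof (intro always_eventually allI)
        fix n
        have "\<bar>arctan (y / \<epsilon> n)\<bar> \<le> pi / 2" using arctan_bounded[of "y / \<epsilon> n"] by auto
        from mult_left_mono[OF this, of "\<epsilon> n / 2"] e[of n]
        show "norm (\<epsilon> n / 2 * arctan (y / \<epsilon> n)) \<le> \<epsilon> n * (pi / 4)" by (simp add: abs_mult)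
      qed
      show "(\<lambda>n. \<epsilon> n * (pi / 4)) \<longlonglongrightarrow> 0" using tendsto_mult_left_zero[OF elim] .
    qed
    then have "(\<lambda>n. F n y) \<longlonglongrightarrow> (y + sqrt (y\<^sup>2 + 0\<^sup>2)) / 2 - 0"
      unfolding F_def by (intro tendsto_intros elim) auto
    also have "(y + sqrt (y\<^sup>2 + 0\<^sup>2)) / 2 - 0 = max y 0" by auto
    finally show ?thesis .
  qed
  show ?thesis
    by (rule is_primitive_limit[OF is_primitiveD(1)[OF u] is_primitive_chain[OF u F f] bd flim Flim])
qed

text \<open>
  The clamped function \<open>max s (min t \<bar>u\<bar>)\<close>, written as a combination of positive parts so
  that the resulting density lives on the open slab \<open>s < \<bar>u\<bar> < t\<close>.
\<close>

lemma is_primitive_clamp_abs: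
  assumes u: "is_primitive u g" and st: "0 \<le> s" "s < t"
  shows "is_primitive (\<lambda>x. max s (min t \<bar>u x\<bar>))
           (\<lambda>x. (if s < \<bar>u x\<bar> \<and> \<bar>u x\<bar> < t then sgn (u x) else 0) * g x)"
proof -
  define \<sigma> where "\<sigma> x = (2 * (if u x > 0 then 1 else 0) - 1) * g x" for x
  have abs0: "is_primitive (\<lambda>x. \<bar>u x\<bar>) \<sigma>"
    by (rule is_primitive_cong[OF is_primitive_add[OF
          is_primitive_affine[OF is_primitive_pos_part[OF u], of 2 0]
          is_primitive_affine[OF u, of "-1" 0]]]) (auto simp: \<sigma>_def)
  note abs = is_primitive_affine[OF abs0, of 1] and nabs = is_primitive_affine[OF abs0, of "-1"]
  note pp = is_primitive_pos_part[OF abs[of "- s"]]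
    is_primitive_affine[OF is_primitive_pos_part[OF nabs[of t]], of "-1" "s + t"]
  show ?thesis
    by (rule is_primitive_cong[OF is_primitive_add[OF is_primitive_add[OF pp] nabs[of 0]]])
      (use st in \<open>auto simp: \<sigma>_def sgn_if\<close>)
qed

section \<open>The energy of a slab\<close>

text \<open>
  The clamped function rises from \<open>s\<close> to \<open>t\<close> before the point \<open>x0\<close> and falls back to \<open>s\<close>
  after it.  This gives the total variation bound, and, applied to the square of the clamped
  function, shows that \<open>u u'\<close> has mean zero over the slab.
\<close>

lemma slab_integrals:
  assumes u: "is_primitive u g" and sup: "compactly_supported u"
    and st: "0 \<le> s" "s < t" and x0: "t \<le> \<bar>u x0\<bar>"
  defines "A \<equiv> {x. s < \<bar>u x\<bar> \<and> \<bar>u x\<bar> < t}"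
  shows "integrable lebesgue (\<lambda>x. indicator A x * \<bar>g x\<bar>)"
    and "integrable lebesgue (\<lambda>x. indicator A x * (g x * u x))"
    and "(LINT x|lebesgue. indicator A x * (g x * u x)) = 0"
    and "2 * (t - s) \<le> (LINT x|lebesgue. indicator A x * \<bar>g x\<bar>)"
proof -
  obtain R where R: "R > 0" "\<And>x. \<bar>x\<bar> \<ge> R \<Longrightarrow> u x = 0" using compactly_supported_radius[OF sup] by blast
  have x0R: "- R \<le> x0" "x0 \<le> R" using R(2)[of x0] x0 st by linarith+
  define w where "w x = max s (min t \<bar>u x\<bar>)" for x
  define k where "k x = (if s < \<bar>u x\<bar> \<and> \<bar>u x\<bar> < t then sgn (u x) else 0) * g x" for x
  have w: "is_primitive w k"
    unfolding w_def[abs_def] k_def[abs_def] by (rule is_primitive_clamp_abs[OF u st])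
  have w2: "is_primitive (\<lambda>x. w x * w x) (\<lambda>x. w x * k x + w x * k x)"
    by (rule is_primitive_times[OF w w])
  have abs_k: "indicator A x * \<bar>g x\<bar> = \<bar>k x\<bar>" for x
    using st by (auto simp: A_def k_def abs_mult sgn_if)
  have wk: "indicator A x * (g x * u x) = 1/2 * (w x * k x + w x * k x)" for x
    using st by (auto simp: A_def k_def w_def sgn_if)
  have k0: "k x = 0" if "x \<notin> {-R..R}" for x
    using R(2)[of x] that st by (auto simp: k_def)
  have kabs: "locally_integrable (\<lambda>x. \<bar>k x\<bar>)"
    using is_primitiveD(1)[OF w] by (rule locally_integrable_abs)
  note c1 = LINT_eq_integral_Icc[OF kabs, of "-R" R]
  have wki: "locally_integrable (\<lambda>x. 1/2 * (w x * k x + w x * k x))"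
    using is_primitiveD(1)[OF w2] by (rule locally_integrable_cmult)
  note c2 = LINT_eq_integral_Icc[OF wki, of "-R" R]
  show "integrable lebesgue (\<lambda>x. indicator A x * \<bar>g x\<bar>)" using c1 k0 by (simp add: abs_k)
  show "integrable lebesgue (\<lambda>x. indicator A x * (g x * u x))" using c2 k0 by (simp only: wk) simp
  have wR: "w R = s" "w (-R) = s" "w x0 = t" using R st x0 by (auto simp: w_def)
  have "(LINT x|lebesgue. indicator A x * (g x * u x)) = integral {-R..R} (\<lambda>x. 1/2 * (w x * k x + w x * k x))"
    using c2 k0 by (simp only: wk) simp
  also have "\<dots> = 1/2 * (w R * w R - w (-R) * w (-R))"
    using is_primitiveD(2)[OF w2, of "-R" R] R(1) by simp
  finally show "(LINT x|lebesgue. indicator A x * (g x * u x)) = 0" using wR by simp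
  have "t - s \<le> integral {-R..x0} (\<lambda>x. \<bar>k x\<bar>)" "t - s \<le> integral {x0..R} (\<lambda>x. \<bar>k x\<bar>)"
  proof -
    have "\<bar>integral {a..b} k\<bar> \<le> integral {a..b} (\<lambda>x. \<bar>k x\<bar>)" for a b
      using integral_norm_bound_integral[of k "{a..b}" "\<lambda>x. \<bar>k x\<bar>"]
        locally_integrableD(2)[OF kabs] locally_integrableD(2)[OF is_primitiveD(1)[OF w]] by simp
    from this[of "-R" x0] this[of x0 R]
    show "t - s \<le> integral {-R..x0} (\<lambda>x. \<bar>k x\<bar>)" "t - s \<le> integral {x0..R} (\<lambda>x. \<bar>k x\<bar>)"
      using is_primitiveD(2)[OF w, of "-R" x0] is_primitiveD(2)[OF w, of x0 R] x0R wR by auto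
  qed
  moreover have "integral {-R..x0} (\<lambda>x. \<bar>k x\<bar>) + integral {x0..R} (\<lambda>x. \<bar>k x\<bar>) = integral {-R..R} (\<lambda>x. \<bar>k x\<bar>)"
    by (rule Henstock_Kurzweil_Integration.integral_combine[OF x0R locally_integrableD(2)[OF kabs]])
  ultimately show "2 * (t - s) \<le> (LINT x|lebesgue. indicator A x * \<bar>g x\<bar>)"
    using c1 k0 by (simp add: abs_k)
qed

lemma powr_ge_tangent:
  fixes q z :: real
  assumes "q \<ge> 1" "z \<ge> 0"
  shows "z powr q \<ge> 1 + q * (z - 1)"
proof (cases "z = 0")
  case False
  then have "(z powr q) powr (1/q) * 1 powr (1 - 1/q) \<le> 1/q * z powr q + (1 - 1/q) * 1"
    using assms by (intro Youngs_inequality_0) auto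
  then have "z \<le> 1/q * z powr q + (1 - 1/q)"
    using assms False by (simp add: powr_powr)
  from mult_left_mono[OF this, of q] assms show ?thesis
    by (simp add: algebra_simps)
qed (use assms in simp)

text \<open>
  Two tangent lines: \<open>z \<mapsto> z powr (p/2)\<close> lies above its tangent at \<open>c\<^sup>2\<close>, being convex for
  \<open>p \<ge> 2\<close>, and \<open>g\<^sup>2\<close> lies above \<open>2 c \<bar>g\<bar> - c\<^sup>2\<close>.  Between the two steps the square of the sum is
  expanded and its last term dropped; the mixed term is kept, as it has mean zero on slabs.
\<close>

lemma powr_perturbed_ge:
  fixes p c g v \<kappa> :: real
  assumes p: "p \<ge> 2" and c: "c > 0"
  shows "\<bar>g + \<kappa> * v\<bar> powr p \<ge> c powr p * (1 + p/2 * ((2 * \<kappa> * (g * v) + 2 * c * \<bar>g\<bar>) / c\<^sup>2 - 2))"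
proof -
  define G where "G = g + \<kappa> * v"
  have "0 \<le> (\<bar>g\<bar> - c)\<^sup>2 + (\<kappa> * v)\<^sup>2" by simp
  then have G: "2 * \<kappa> * (g * v) + 2 * c * \<bar>g\<bar> - c\<^sup>2 \<le> G\<^sup>2"
    unfolding G_def by (simp add: power2_eq_square algebra_simps)
  have "(2 * \<kappa> * (g * v) + 2 * c * \<bar>g\<bar>) / c\<^sup>2 - 2 \<le> G\<^sup>2 / c\<^sup>2 - 1"
    using divide_right_mono[OF G, of "c\<^sup>2"] c by (simp add: diff_divide_distrib)
  then have "1 + p/2 * ((2 * \<kappa> * (g * v) + 2 * c * \<bar>g\<bar>) / c\<^sup>2 - 2) \<le> 1 + p/2 * (G\<^sup>2 / c\<^sup>2 - 1)"
    using p by (intro add_left_mono mult_left_mono) auto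
  also have "\<dots> \<le> (G\<^sup>2 / c\<^sup>2) powr (p/2)"
    using p by (intro powr_ge_tangent) auto
  also have "G\<^sup>2 / c\<^sup>2 = (\<bar>G\<bar> / c) powr 2"
    using c by (simp add: power_divide powr_numeral)
  also have "((\<bar>G\<bar> / c) powr 2) powr (p/2) = (\<bar>G\<bar> / c) powr p"
    by (simp add: powr_powr)
  also have "\<dots> = \<bar>G\<bar> powr p / c powr p"
    using c by (simp add: powr_divide)
  finally show ?thesis
    using c by (simp add: G_def field_simps)
qed

lemma integral_le_nn_integral_pos_part:
  fixes B :: "'a \<Rightarrow> real"
  assumes "integrable M B"
  shows "ennreal (integral\<^sup>L M B) \<le> (\<integral>\<^sup>+ x. ennreal (B x) \<partial>M)"
proof -
  have i: "integrable M (\<lambda>x. max (B x) 0)" using assms by simp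
  have "integral\<^sup>L M B \<le> integral\<^sup>L M (\<lambda>x. max (B x) 0)"
    by (rule integral_mono[OF assms i]) simp
  then have "ennreal (integral\<^sup>L M B) \<le> ennreal (integral\<^sup>L M (\<lambda>x. max (B x) 0))"
    by (rule ennreal_leI)
  also have "\<dots> = (\<integral>\<^sup>+ x. ennreal (max (B x) 0) \<partial>M)"
    by (rule nn_integral_eq_integral[symmetric, OF i]) simp
  also have "\<dots> = (\<integral>\<^sup>+ x. ennreal (B x) \<partial>M)"
    by (intro nn_integral_cong) (simp add: max_def ennreal_neg)
  finally show ?thesis .
qed

lemma slab_open:
  fixes u :: "real \<Rightarrow> real"
  assumes "continuous_on UNIV u"
  shows "open {x. s < \<bar>u x\<bar> \<and> \<bar>u x\<bar> < t}"
  by (intro open_Collect_conj open_Collect_less continuous_intros assms)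

text \<open>
  The pointwise bound \<open>powr_perturbed_ge\<close> is integrated over the slab, with \<open>c\<close> the slope of
  a function that descends linearly from \<open>t\<close> to \<open>s\<close> over a distance \<open>d\<close>.  The
  \<open>\<kappa>\<close>-term integrates to zero, and what remains decreases with the measure of the slab, which
  is therefore replaced by its upper bound \<open>2 * d\<close>.
\<close>

lemma slab_energy:
  fixes p \<kappa> d s t :: real
  assumes p: "2 \<le> p" and u: "is_primitive u g" and sup: "compactly_supported u"
    and st: "0 \<le> s" "s < t" and x0: "t \<le> \<bar>u x0\<bar>" and d: "d > 0"
  defines "A \<equiv> {x. s < \<bar>u x\<bar> \<and> \<bar>u x\<bar> < t}"
  assumes A: "emeasure lebesgue A \<le> ennreal (2 * d)"
  shows "ennreal (2 * ((t - s) powr p / d powr (p - 1)))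
    \<le> (\<integral>\<^sup>+ x. ennreal (\<bar>g x + \<kappa> * u x\<bar> powr p) * indicator A x \<partial>lebesgue)"
proof -
  define c where "c = (t - s) / d"
  have c: "c > 0" using st d by (simp add: c_def)
  define I where "I = (LINT x|lebesgue. indicator A x * \<bar>g x\<bar>)"
  note slab = slab_integrals[OF u sup st x0, folded A_def]
  have A_sets: "A \<in> sets lebesgue"
    unfolding A_def using slab_open[OF is_primitive_continuous[OF u]] by auto
  have A_fin: "emeasure lebesgue A < \<infinity>"
    using A by (rule order.strict_trans1) simp
  define m where "m = measure lebesgue A"
  have m: "0 \<le> m" "m \<le> 2 * d"
    using A A_fin d by (auto simp: m_def measure_def intro: enn2real_leI)
  have indA: "integrable lebesgue (indicator A :: real \<Rightarrow> real)" "(LINT x|lebesgue. indicator A x) = m"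
    using A_sets A_fin by (auto simp: m_def)
  define B where "B x = c powr p * ((1 - p) * indicator A x
      + p * \<kappa> / c\<^sup>2 * (indicator A x * (g x * u x)) + p / c * (indicator A x * \<bar>g x\<bar>))" for x
  have B_int: "integrable lebesgue B"
    unfolding B_def by (intro integrable_mult_right Bochner_Integration.integrable_add slab indA)
  have B_le: "B x \<le> \<bar>g x + \<kappa> * u x\<bar> powr p * indicator A x" for x
  proof (cases "x \<in> A")
    case True
    have "(1 - p) + p * \<kappa> / c\<^sup>2 * (g x * u x) + p / c * \<bar>g x\<bar>
        = 1 + p/2 * ((2 * \<kappa> * (g x * u x) + 2 * c * \<bar>g x\<bar>) / c\<^sup>2 - 2)"
      using c by (simp add: field_simps power2_eq_square)
    with True powr_perturbed_ge[OF p c, where g = "g x" and \<kappa> = \<kappa> and v = "u x"] show ?thesis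
      unfolding B_def by (simp only: indicator_simps mult_1_right mult_1_left)
  qed (simp add: B_def)
  have "2 * ((t - s) powr p / d powr (p - 1)) = c powr p * (2 * d)"
    using d st p by (simp add: c_def powr_divide powr_diff)
  also have "\<dots> \<le> c powr p * ((1 - p) * m + p / c * I)"
  proof -
    have "2 * (c * d) \<le> I" using slab(4) d by (simp add: I_def c_def)
    then have "2 * d \<le> I / c" using c by (simp add: field_simps)
    then have "p * (2 * d) \<le> p * (I / c)" using p by (intro mult_left_mono) auto
    moreover have "(p - 1) * m \<le> (p - 1) * (2 * d)" using p m by (intro mult_left_mono) auto
    ultimately have "2 * d \<le> (1 - p) * m + p / c * I" by (simp add: algebra_simps)
    then show ?thesis by (intro mult_left_mono) auto
  qed
  also have "\<dots> = integral\<^sup>L lebesgue B"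
    unfolding B_def using slab indA by (simp add: I_def)
  finally have "ennreal (2 * ((t - s) powr p / d powr (p - 1))) \<le> ennreal (integral\<^sup>L lebesgue B)"
    by (rule ennreal_leI)
  also have "\<dots> \<le> (\<integral>\<^sup>+ x. ennreal (B x) \<partial>lebesgue)"
    by (rule integral_le_nn_integral_pos_part[OF B_int])
  also have "\<dots> \<le> (\<integral>\<^sup>+ x. ennreal (\<bar>g x + \<kappa> * u x\<bar> powr p) * indicator A x \<partial>lebesgue)"
    using B_le by (intro nn_integral_mono) (auto simp: ennreal_indicator[symmetric] ennreal_mult''[symmetric] intro: ennreal_leI)
  finally show ?thesis .
qed

section \<open>The rearrangement on a uniform partition\<close>

definition rearr :: "(real \<Rightarrow> real) \<Rightarrow> real \<Rightarrow> real" where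
  "rearr u y = enn2real (symm_decr_rearrangement u y)"

lemma rearr_nonneg: "0 \<le> rearr u y" by (simp add: rearr_def)

lemma rearr_minus: "rearr u (- y) = rearr u y"
  by (simp add: rearr_def symm_decr_rearrangement_def)

lemma abs_attains_max:
  fixes u :: "real \<Rightarrow> real"
  assumes "continuous_on UNIV u" "compactly_supported u"
  obtains x0 where "\<And>x. \<bar>u x\<bar> \<le> \<bar>u x0\<bar>"
proof -
  obtain R where R: "R > 0" "\<And>x. \<bar>x\<bar> \<ge> R \<Longrightarrow> u x = 0" using compactly_supported_radius[OF assms(2)] by blast
  have "continuous_on {-R..R} (\<lambda>x. \<bar>u x\<bar>)"
    by (intro continuous_intros continuous_on_subset[OF assms(1)]) auto
  then have "\<exists>x0\<in>{-R..R}. \<forall>x\<in>{-R..R}. \<bar>u x\<bar> \<le> \<bar>u x0\<bar>"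
    using R(1) by (intro continuous_attains_sup) auto
  then obtain x0 where x0: "\<And>x. x \<in> {-R..R} \<Longrightarrow> \<bar>u x\<bar> \<le> \<bar>u x0\<bar>" by blast
  have "\<bar>u x\<bar> \<le> \<bar>u x0\<bar>" for x
  proof (cases "\<bar>x\<bar> \<ge> R")
    case False
    then show ?thesis by (intro x0) auto
  qed (simp add: R(2))
  then show ?thesis by (rule that)
qed

lemma superlevel_measurable:
  fixes u :: "real \<Rightarrow> real"
  assumes "continuous_on UNIV u"
  shows "{x. t < \<bar>u x\<bar>} \<in> sets lebesgue" "{x. t \<le> \<bar>u x\<bar>} \<in> sets lebesgue"
proof -
  have "open {x. t < \<bar>u x\<bar>}" "closed {x. t \<le> \<bar>u x\<bar>}"
    by (intro open_Collect_less closed_Collect_le continuous_intros assms)+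
  then show "{x. t < \<bar>u x\<bar>} \<in> sets lebesgue" "{x. t \<le> \<bar>u x\<bar>} \<in> sets lebesgue" by auto
qed

lemma distribution_function_mono:
  assumes "continuous_on UNIV u" "s \<le> t"
  shows "distribution_function u t \<le> distribution_function u s"
  unfolding distribution_function_def
  by (rule emeasure_mono) (use assms superlevel_measurable in auto)

lemma distribution_function_finite:
  assumes "continuous_on UNIV u" "compactly_supported u" "0 \<le> t"
  shows "distribution_function u t < \<infinity>"
proof -
  obtain R where R: "R > 0" "\<And>x. \<bar>x\<bar> \<ge> R \<Longrightarrow> u x = 0" using compactly_supported_radius[OF assms(2)] by blast
  have "x \<in> {-R..R}" if "t < \<bar>u x\<bar>" for x
    using R(2)[of x] assms(3) that by (cases "\<bar>x\<bar> \<ge> R") auto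
  then have "{x. t < \<bar>u x\<bar>} \<subseteq> {-R..R}" by blast
  then have "distribution_function u t \<le> emeasure lebesgue {-R..R}"
    unfolding distribution_function_def by (rule emeasure_mono) auto
  also have "\<dots> < \<infinity>" using R by simp
  finally show ?thesis .
qed

context
  fixes u :: "real \<Rightarrow> real"
  assumes cont: "continuous_on UNIV u" and sup: "compactly_supported u"
begin

lemma rearr_zero_eq_max:
  assumes "\<And>x. \<bar>u x\<bar> \<le> \<bar>u x0\<bar>"
  shows "rearr u 0 = \<bar>u x0\<bar>"
proof -
  have "(SUP y. ennreal \<bar>u y\<bar>) = ennreal \<bar>u x0\<bar>"
    by (intro antisym SUP_least SUP_upper2[of x0] ennreal_leI assms) auto
  then show ?thesis by (simp add: rearr_def symm_decr_rearrangement_def)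
qed

text \<open>
  Only levels \<open>t \<ge> 0\<close> compete in the infimum, hence the positivity assumptions in what follows.
\<close>

lemma rearr_le:
  assumes "0 \<le> t" "distribution_function u t < ennreal (2 * \<bar>y\<bar>)"
  shows "rearr u y \<le> t"
proof -
  have "y \<noteq> 0" using assms(2) by auto
  then have "symm_decr_rearrangement u y \<le> ennreal t"
    unfolding symm_decr_rearrangement_def using assms by (auto intro!: Inf_lower)
  then show ?thesis using assms(1) by (simp add: rearr_def enn2real_leI)
qed

text \<open>
  The superlevel set at the infimum is the increasing union of those at larger levels, all of
  which are small.
\<close>

lemma distribution_function_rearr_le: "distribution_function u (rearr u y) \<le> ennreal (2 * \<bar>y\<bar>)"
proof -
  obtain x0 where x0: "\<And>x. \<bar>u x\<bar> \<le> \<bar>u x0\<bar>" using abs_attains_max[OF cont sup] by blast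
  have empty: "distribution_function u \<bar>u x0\<bar> = 0"
    using x0 by (auto simp: distribution_function_def not_less[symmetric])
  show ?thesis
  proof (cases "y = 0")
    case True
    then show ?thesis using empty rearr_zero_eq_max[OF x0] by simp
  next
    case y: False
    let ?S = "{ennreal t | t. t \<ge> 0 \<and> distribution_function u t < ennreal (2 * \<bar>y\<bar>)}"
    have S: "symm_decr_rearrangement u y = Inf ?S" using y by (simp add: symm_decr_rearrangement_def)
    have "ennreal \<bar>u x0\<bar> \<in> ?S" using empty y by (auto intro!: exI[of _ "\<bar>u x0\<bar>"])
    then have "Inf ?S \<le> ennreal \<bar>u x0\<bar>" by (rule Inf_lower)
    then have "Inf ?S < top" using ennreal_less_top by (rule le_less_trans)
    then have S': "Inf ?S = ennreal (rearr u y)" unfolding rearr_def S by simp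
    have less: "distribution_function u t \<le> ennreal (2 * \<bar>y\<bar>)" if "rearr u y < t" for t
    proof -
      have "Inf ?S < ennreal t" using that rearr_nonneg[of u y] by (simp add: S' ennreal_less_iff)
      then obtain t' where t': "t' \<ge> 0" "distribution_function u t' < ennreal (2 * \<bar>y\<bar>)" "ennreal t' < ennreal t"
        unfolding Inf_less_iff by blast
      then have "t' \<le> t" by (simp add: ennreal_less_iff)
      from distribution_function_mono[OF cont this] t'(2) show ?thesis by simp
    qed
    have "{x. rearr u y < \<bar>u x\<bar>} = (\<Union>n. {x. rearr u y + inverse (real (Suc n)) < \<bar>u x\<bar>})"
    proof (intro set_eqI iffI)
      fix x assume "x \<in> {x. rearr u y < \<bar>u x\<bar>}"
      then obtain n where "inverse (real (Suc n)) < \<bar>u x\<bar> - rearr u y"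
        using reals_Archimedean[of "\<bar>u x\<bar> - rearr u y"] by auto
      then show "x \<in> (\<Union>n. {x. rearr u y + inverse (real (Suc n)) < \<bar>u x\<bar>})" by (auto intro!: exI[of _ n])
    next
      fix x assume "x \<in> (\<Union>n. {x. rearr u y + inverse (real (Suc n)) < \<bar>u x\<bar>})"
      then obtain n where "rearr u y + inverse (real (Suc n)) < \<bar>u x\<bar>" by blast
      moreover have "inverse (real (Suc n)) > 0" by simp
      ultimately have "rearr u y < \<bar>u x\<bar>" by linarith
      then show "x \<in> {x. rearr u y < \<bar>u x\<bar>}" by simp
    qed
    then have "distribution_function u (rearr u y) =
        (SUP n. distribution_function u (rearr u y + inverse (real (Suc n))))"
      unfolding distribution_function_def
      by (subst SUP_emeasure_incseq)
        (auto simp: incseq_def superlevel_measurable[OF cont] simp del: of_nat_Suc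
          intro: order.strict_trans1[rotated] simp: le_imp_inverse_le)
    also have "\<dots> \<le> ennreal (2 * \<bar>y\<bar>)"
      by (intro SUP_least less) simp
    finally show ?thesis .
  qed
qed

text \<open>
  Dually, the closed superlevel set is the decreasing intersection of those at smaller levels,
  none of which competes in the infimum.  The two bounds differ when \<open>\<bar>u\<bar>\<close> has a
  plateau at this level.
\<close>

lemma superlevel_rearr_ge:
  assumes "0 < rearr u y"
  shows "ennreal (2 * \<bar>y\<bar>) \<le> emeasure lebesgue {x. rearr u y \<le> \<bar>u x\<bar>}"
proof -
  define t where "t n = rearr u y * (1 - inverse (real (Suc n)))" for n
  have t: "0 \<le> t n" "t n < rearr u y" for n
    using assms by (auto simp: t_def inverse_le_1_iff)
  have tinc: "t n \<le> t m" if "n \<le> m" for n m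
    using that assms by (auto simp: t_def le_imp_inverse_le)
  have tlim: "t \<longlonglongrightarrow> rearr u y * (1 - 0)"
    unfolding t_def by (intro tendsto_intros LIMSEQ_inverse_real_of_nat)
  have eq: "{x. rearr u y \<le> \<bar>u x\<bar>} = (\<Inter>n. {x. t n < \<bar>u x\<bar>})"
  proof (intro set_eqI iffI)
    fix x assume "x \<in> (\<Inter>n. {x. t n < \<bar>u x\<bar>})"
    then have "t n \<le> \<bar>u x\<bar>" for n by (simp add: less_imp_le)
    then have "rearr u y * (1 - 0) \<le> \<bar>u x\<bar>" by (intro LIMSEQ_le_const2[OF tlim]) auto
    then show "x \<in> {x. rearr u y \<le> \<bar>u x\<bar>}" by simp
  qed (use t in \<open>auto intro: less_le_trans\<close>)
  have "ennreal (2 * \<bar>y\<bar>) \<le> distribution_function u (t n)" for n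
    using rearr_le[OF t(1), of n y] t(2)[of n] by (meson not_le)
  then have "ennreal (2 * \<bar>y\<bar>) \<le> (INF n. distribution_function u (t n))"
    by (intro INF_greatest)
  also have "\<dots> = emeasure lebesgue {x. rearr u y \<le> \<bar>u x\<bar>}"
    unfolding eq distribution_function_def
    using distribution_function_finite[OF cont sup t(1)] tinc
    by (intro INF_emeasure_decseq)
      (auto simp: superlevel_measurable[OF cont] decseq_def distribution_function_def less_top
        intro: le_less_trans)
  finally show ?thesis .
qed

lemma rearr_antimono:
  assumes "\<bar>x\<bar> \<le> \<bar>y\<bar>"
  shows "rearr u y \<le> rearr u x"
proof (cases "\<bar>x\<bar> = \<bar>y\<bar>")
  case True
  then show ?thesis using rearr_minus by (metis abs_eq_iff order_refl)
next
  case False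
  then have "distribution_function u (rearr u x) < ennreal (2 * \<bar>y\<bar>)"
    using assms by (intro order.strict_trans1[OF distribution_function_rearr_le]) (simp add: ennreal_less_iff)
  then show ?thesis by (rule rearr_le[OF rearr_nonneg])
qed

text \<open>
  The slab is the open superlevel set at the lower value minus the closed one at the upper value.
\<close>

lemma slab_between_rearr_measure:
  assumes xy: "0 \<le> x" "x \<le> y" and less: "rearr u y < rearr u x"
  shows "emeasure lebesgue {z. rearr u y < \<bar>u z\<bar> \<and> \<bar>u z\<bar> < rearr u x} \<le> ennreal (2 * (y - x))"
    (is "emeasure lebesgue ?A \<le> _")
proof -
  have A: "?A \<in> sets lebesgue" using slab_open[OF cont] by auto
  have "emeasure lebesgue ?A + ennreal (2 * x) \<le> emeasure lebesgue ?A + emeasure lebesgue {z. rearr u x \<le> \<bar>u z\<bar>}"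
    using superlevel_rearr_ge[of x] less rearr_nonneg[of u y] xy by (intro add_left_mono) auto
  also have "\<dots> = emeasure lebesgue (?A \<union> {z. rearr u x \<le> \<bar>u z\<bar>})"
    by (rule plus_emeasure[OF A superlevel_measurable(2)[OF cont]]) auto
  also have "\<dots> \<le> distribution_function u (rearr u y)"
    unfolding distribution_function_def
    by (rule emeasure_mono) (use less superlevel_measurable[OF cont] in auto)
  also have "\<dots> \<le> ennreal (2 * y)" using distribution_function_rearr_le[of y] xy by simp
  finally have "emeasure lebesgue ?A + ennreal (2 * x) - ennreal (2 * x) \<le> ennreal (2 * y) - ennreal (2 * x)"
    by (rule ennreal_minus_mono) simp
  then show ?thesis using xy by (simp add: ennreal_minus[symmetric] right_diff_distrib)
qed

end

text \<open>
  The slabs between the values of the rearrangement along a uniform partition are disjoint, so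
  their energies add up to at most the total energy.
\<close>

lemma rearr_partition_energy:
  assumes p: "2 \<le> p" and u: "is_primitive u g" and sup: "compactly_supported u"
    and d: "\<delta> > 0" and th: "\<theta> \<ge> 0"
  shows "(\<Sum>j<N. ennreal (2 * ((rearr u (\<theta> + real j * \<delta>) - rearr u (\<theta> + real (Suc j) * \<delta>)) powr p
            / \<delta> powr (p - 1))))
      \<le> (\<integral>\<^sup>+ x. ennreal (\<bar>g x + \<kappa> * u x\<bar> powr p) \<partial>lebesgue)"
proof -
  note cont = is_primitive_continuous[OF u]
  define y where "y j = \<theta> + real j * \<delta>" for j
  define A where "A j = {x. rearr u (y (Suc j)) < \<bar>u x\<bar> \<and> \<bar>u x\<bar> < rearr u (y j)}" for j
  define f where "f x = ennreal (\<bar>g x + \<kappa> * u x\<bar> powr p)" for x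
  have y: "0 \<le> y j" "y (Suc j) - y j = \<delta>" for j
    using d th by (auto simp: y_def algebra_simps)
  have yle: "y i \<le> y j" if "i \<le> j" for i j
    using that d by (auto simp: y_def mult_right_mono)
  have mono: "rearr u (y j) \<le> rearr u (y i)" if "i \<le> j" for i j
    using yle[OF that] y(1)[of i] by (intro rearr_antimono[OF cont sup]) auto
  obtain x0 where x0: "\<And>x. \<bar>u x\<bar> \<le> \<bar>u x0\<bar>" using abs_attains_max[OF cont sup] by blast
  have le_max: "rearr u z \<le> \<bar>u x0\<bar>" for z
    using rearr_antimono[OF cont sup, of 0 z] rearr_zero_eq_max[OF cont sup x0] by simp
  have term_le: "ennreal (2 * ((rearr u (y j) - rearr u (y (Suc j))) powr p / \<delta> powr (p - 1)))
      \<le> (\<integral>\<^sup>+ x. f x * indicator (A j) x \<partial>lebesgue)" for j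
  proof (cases "rearr u (y (Suc j)) < rearr u (y j)")
    case True
    then show ?thesis
      using slab_between_rearr_measure[OF cont sup y(1) yle[of j "Suc j"] True] y(2)[of j]
      unfolding f_def A_def
      by (intro slab_energy[OF p u sup rearr_nonneg True le_max d]) auto
  next
    case False
    then have "rearr u (y j) = rearr u (y (Suc j))" using mono[of j "Suc j"] by simp
    then show ?thesis by simp
  qed
  have disj: "disjoint_family_on A {..<N}"
    unfolding disjoint_family_on_def
  proof (intro ballI impI)
    fix i j :: nat assume "i \<noteq> j"
    then consider "Suc i \<le> j" | "Suc j \<le> i" by linarith
    then show "A i \<inter> A j = {}"
      by cases (use mono in \<open>force simp: A_def\<close>)+
  qed
  have A_sets: "A j \<in> sets lebesgue" for j
    unfolding A_def using slab_open[OF cont] by auto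
  have [measurable]: "g \<in> borel_measurable lebesgue" "u \<in> borel_measurable lebesgue"
    using locally_integrable_measurable is_primitiveD(1)[OF u] locally_integrable_continuous[OF cont]
    by auto
  have f_meas: "f \<in> borel_measurable lebesgue" unfolding f_def by measurable
  have "(\<Sum>j<N. ennreal (2 * ((rearr u (y j) - rearr u (y (Suc j))) powr p / \<delta> powr (p - 1))))
      \<le> (\<Sum>j<N. \<integral>\<^sup>+ x. f x * indicator (A j) x \<partial>lebesgue)"
    by (intro sum_mono term_le)
  also have "\<dots> = (\<integral>\<^sup>+ x. (\<Sum>j<N. f x * indicator (A j) x) \<partial>lebesgue)"
    using A_sets f_meas by (intro nn_integral_sum[symmetric]) auto
  also have "\<dots> = (\<integral>\<^sup>+ x. f x * indicator (\<Union>j<N. A j) x \<partial>lebesgue)"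
    by (simp add: sum_distrib_left[symmetric] indicator_UN_disjoint[OF _ disj])
  also have "\<dots> \<le> (\<integral>\<^sup>+ x. f x \<partial>lebesgue)"
    by (intro nn_integral_mono) (auto simp: indicator_def)
  finally show ?thesis unfolding f_def y_def .
qed

section \<open>Functions with bounded Riesz sums\<close>

text \<open>
  Slopes \<open>D / d\<close> up to \<open>c\<close> are covered by the first term; steeper ones are dominated by their
  \<open>p\<close>-energy.  The free parameter \<open>c\<close> is what yields absolute continuity later on.
\<close>

lemma powr_tangent_split:
  fixes D d c p :: real
  assumes "0 \<le> D" "0 < d" "0 < c" "1 \<le> p"
  shows "D \<le> c * d + D powr p / d powr (p - 1) / c powr (p - 1)"
proof (cases "D \<le> c * d")
  case False
  then have cd: "0 < c * d" "c * d < D" using assms by auto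
  then have "1 \<le> (D / (c * d)) powr (p - 1)"
    using assms by (intro ge_one_powr_ge_zero) auto
  then have "D * 1 \<le> D * (D / (c * d)) powr (p - 1)"
    using assms by (intro mult_left_mono) auto
  also have "\<dots> = D powr p / d powr (p - 1) / c powr (p - 1)"
    using cd assms by (simp add: powr_divide powr_mult powr_diff field_simps)
  finally show ?thesis using cd by simp
qed (use assms in \<open>auto intro: add_increasing2\<close>)

lemma powr_small:
  fixes K p \<epsilon> :: real
  assumes "0 \<le> K" "p > 1" "\<epsilon> > 0"
  obtains c where "c > 0" "K / c powr (p - 1) < \<epsilon>"
proof (rule that[of "((K + 1) / \<epsilon>) powr (1 / (p - 1))"])
  show "((K + 1) / \<epsilon>) powr (1 / (p - 1)) > 0" using assms by simp
  have "(((K + 1) / \<epsilon>) powr (1 / (p - 1))) powr (p - 1) = (K + 1) / \<epsilon>"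
    using assms by (simp add: powr_powr)
  then show "K / (((K + 1) / \<epsilon>) powr (1 / (p - 1))) powr (p - 1) < \<epsilon>"
    using assms by (simp add: field_simps)
qed

text \<open>
  Riesz's condition for a derivative in \<open>L\<^sup>p\<close> on the half-line, over uniform partitions.  The
  offset \<open>\<theta>\<close> is arbitrary, because \<open>riesz_bound_energy\<close> averages over it.
\<close>

definition riesz_bound :: "real \<Rightarrow> real \<Rightarrow> (real \<Rightarrow> real) \<Rightarrow> bool" where
  "riesz_bound p K V \<longleftrightarrow> (\<forall>\<theta> \<delta> N. 0 \<le> \<theta> \<longrightarrow> 0 < \<delta> \<longrightarrow>
     (\<Sum>j<N. \<bar>V (\<theta> + real j * \<delta>) - V (\<theta> + real (Suc j) * \<delta>)\<bar> powr p / \<delta> powr (p - 1)) \<le> K)"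

lemma riesz_boundD:
  assumes "riesz_bound p K V" "0 \<le> \<theta>" "0 < \<delta>"
  shows "(\<Sum>j<N. \<bar>V (\<theta> + real j * \<delta>) - V (\<theta> + real (Suc j) * \<delta>)\<bar> powr p / \<delta> powr (p - 1)) \<le> K"
  using assms unfolding riesz_bound_def by blast

lemma uniform_cells_disjoint:
  fixes d :: real
  assumes "0 \<le> d"
  shows "disjoint_family (\<lambda>j. {real j * d<..real (Suc j) * d})"
  unfolding disjoint_family_on_def
proof (intro ballI impI)
  fix i j :: nat assume "i \<noteq> j"
  then consider "Suc i \<le> j" | "Suc j \<le> i" by linarith
  moreover have "real k * d \<le> real l * d" if "k \<le> l" for k l
    using that assms by (simp add: mult_right_mono)
  ultimately show "{real i * d<..real (Suc i) * d} \<inter> {real j * d<..real (Suc j) * d} = {}"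
    by cases (fastforce dest: order.strict_trans1 simp del: of_nat_Suc)+
qed

lemma uniform_cell_containing:
  fixes d x :: real
  assumes "0 < d" "0 < x"
  obtains k where "real k * d < x" "x \<le> real (Suc k) * d"
proof -
  define k where "k = nat (\<lceil>x / d\<rceil> - 1)"
  have "0 < \<lceil>x / d\<rceil>" using assms by simp
  then have "real k = of_int \<lceil>x / d\<rceil> - 1" by (simp add: k_def)
  then have "real k < x / d" "x / d \<le> real (Suc k)"
    using ceiling_correct[of "x / d"] by auto
  then show ?thesis using assms(1) by (intro that[of k]) (auto simp: field_simps)
qed

lemma nn_integral_half_line_cells:
  fixes q :: "real \<Rightarrow> ennreal"
  assumes [measurable]: "q \<in> borel_measurable borel" and d: "0 < \<delta>"
  shows "(\<integral>\<^sup>+ x. q x * indicator {0<..} x \<partial>lborel)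
       = (\<integral>\<^sup>+ \<theta>. (\<Sum>j. q (\<theta> + real j * \<delta>)) * indicator {0<..\<delta>} \<theta> \<partial>lborel)"
proof -
  define I where "I j = {real j * \<delta><..real (Suc j) * \<delta>}" for j
  have disj: "disjoint_family I"
    unfolding I_def using d by (intro uniform_cells_disjoint) simp
  have un: "{0<..} = (\<Union>j. I j)"
  proof (intro set_eqI iffI)
    fix x :: real assume x: "x \<in> {0<..}"
    obtain k where "real k * \<delta> < x" "x \<le> real (Suc k) * \<delta>"
      using uniform_cell_containing[OF d] x by (metis greaterThan_iff)
    then have "x \<in> I k" by (simp add: I_def)
    then show "x \<in> (\<Union>j. I j)" by blast
  next
    fix x assume "x \<in> (\<Union>j. I j)"
    then obtain j where "x \<in> I j" by blast
    moreover have "0 \<le> real j * \<delta>" using d by simp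
    ultimately show "x \<in> {0<..}" by (simp add: I_def)
  qed
  have [measurable]: "I j \<in> sets borel" for j by (simp add: I_def)
  have "(\<integral>\<^sup>+ x. q x * indicator {0<..} x \<partial>lborel) = (\<integral>\<^sup>+ x. (\<Sum>j. q x * indicator (I j) x) \<partial>lborel)"
    unfolding un using suminf_indicator[OF disj] by (simp add: ennreal_suminf_cmult)
  also have "\<dots> = (\<Sum>j. \<integral>\<^sup>+ x. q x * indicator (I j) x \<partial>lborel)"
    by (intro nn_integral_suminf) measurable
  also have "\<dots> = (\<Sum>j. \<integral>\<^sup>+ \<theta>. q (\<theta> + real j * \<delta>) * indicator {0<..\<delta>} \<theta> \<partial>lborel)"
  proof (intro suminf_cong)
    fix j
    have "(\<integral>\<^sup>+ x. q x * indicator (I j) x \<partial>lborel)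
        = (\<integral>\<^sup>+ \<theta>. q (real j * \<delta> + 1 * \<theta>) * indicator (I j) (real j * \<delta> + 1 * \<theta>) \<partial>lborel)"
      by (subst nn_integral_real_affine[where c = 1 and t = "real j * \<delta>"]) auto
    also have "\<dots> = (\<integral>\<^sup>+ \<theta>. q (\<theta> + real j * \<delta>) * indicator {0<..\<delta>} \<theta> \<partial>lborel)"
      by (intro nn_integral_cong) (auto simp: I_def indicator_def algebra_simps)
    finally show "(\<integral>\<^sup>+ x. q x * indicator (I j) x \<partial>lborel)
        = (\<integral>\<^sup>+ \<theta>. q (\<theta> + real j * \<delta>) * indicator {0<..\<delta>} \<theta> \<partial>lborel)" .
  qed
  also have "\<dots> = (\<integral>\<^sup>+ \<theta>. (\<Sum>j. q (\<theta> + real j * \<delta>) * indicator {0<..\<delta>} \<theta>) \<partial>lborel)"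
    by (intro nn_integral_suminf[symmetric]) measurable
  also have "\<dots> = (\<integral>\<^sup>+ \<theta>. (\<Sum>j. q (\<theta> + real j * \<delta>)) * indicator {0<..\<delta>} \<theta> \<partial>lborel)"
    by simp
  finally show ?thesis .
qed

text \<open>
  By Fatou's lemma the energy is at most that of the difference quotients with increment \<open>\<delta>\<close>.
  Splitting the half-line into translates of one cell of length \<open>\<delta>\<close> turns the latter into an
  average of partition sums.
\<close>

lemma riesz_bound_energy:
  assumes V: "is_primitive V g" and p: "p \<ge> 1" and bd: "riesz_bound p K V" and K: "0 \<le> K"
  shows "(\<integral>\<^sup>+ x. ennreal (\<bar>g x\<bar> powr p) * indicator {0<..} x \<partial>lebesgue) \<le> ennreal K"
proof -
  have [measurable]: "V \<in> borel_measurable borel"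
    using is_primitive_continuous[OF V] by (rule borel_measurable_continuous_onI)
  define d where "d n = 1 / real (Suc n)" for n
  have d: "d n > 0" for n by (simp add: d_def)
  define q where "q n x = ennreal ((\<bar>V (x + d n) - V x\<bar> / d n) powr p)" for n x
  have q_meas[measurable]: "q n \<in> borel_measurable borel" for n
    unfolding q_def by measurable
  have q_le: "(\<integral>\<^sup>+ x. q n x * indicator {0<..} x \<partial>lborel) \<le> ennreal K" for n
  proof -
    have "(\<Sum>j. q n (\<theta> + real j * d n)) \<le> ennreal (K / d n)" if "\<theta> \<ge> 0" for \<theta>
    proof (rule suminf_le_const)
      fix N
      have "(\<Sum>j<N. q n (\<theta> + real j * d n))
          = ennreal (\<Sum>j<N. (\<bar>V (\<theta> + real j * d n + d n) - V (\<theta> + real j * d n)\<bar> / d n) powr p)"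
        unfolding q_def by (rule sum_ennreal) simp
      also have "(\<Sum>j<N. (\<bar>V (\<theta> + real j * d n + d n) - V (\<theta> + real j * d n)\<bar> / d n) powr p)
          = (\<Sum>j<N. \<bar>V (\<theta> + real j * d n) - V (\<theta> + real (Suc j) * d n)\<bar> powr p / d n powr (p - 1)) / d n"
        unfolding sum_divide_distrib
      proof (rule sum.cong[OF refl])
        fix j
        have e: "\<theta> + real (Suc j) * d n = \<theta> + real j * d n + d n" by (simp add: algebra_simps)
        show "(\<bar>V (\<theta> + real j * d n + d n) - V (\<theta> + real j * d n)\<bar> / d n) powr p
          = \<bar>V (\<theta> + real j * d n) - V (\<theta> + real (Suc j) * d n)\<bar> powr p / d n powr (p - 1) / d n"
          unfolding e using d[of n] by (simp add: powr_divide powr_diff abs_minus_commute)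
      qed
      also have "ennreal \<dots> \<le> ennreal (K / d n)"
        using riesz_boundD[OF bd that d[of n], of N] d[of n] by (intro ennreal_leI divide_right_mono) auto
      finally show "(\<Sum>j<N. q n (\<theta> + real j * d n)) \<le> ennreal (K / d n)" .
    qed simp
    then have "(\<integral>\<^sup>+ x. q n x * indicator {0<..} x \<partial>lborel)
        \<le> (\<integral>\<^sup>+ \<theta>. ennreal (K / d n) * indicator {0<..d n} \<theta> \<partial>lborel)"
      unfolding nn_integral_half_line_cells[where \<delta> = "d n", OF q_meas d]
      by (intro nn_integral_mono) (auto simp: indicator_def)
    also have "\<dots> = ennreal (K / d n) * ennreal (d n)"
      using d[of n] by (subst nn_integral_cmult_indicator) auto
    also have "\<dots> = ennreal K"
      using d[of n] K by (simp add: ennreal_mult[symmetric])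
    finally show ?thesis .
  qed
  have lim: "AE x in lebesgue. (\<lambda>n. q n x) \<longlonglongrightarrow> ennreal (\<bar>g x\<bar> powr p)"
    using AE_difference_quotient_tendsto[OF V]
  proof eventually_elim
    case (elim x)
    have "(\<lambda>n. ennreal (\<bar>real (Suc n) * (V (x + 1 / real (Suc n)) - V x)\<bar> powr p)) \<longlonglongrightarrow> ennreal (\<bar>g x\<bar> powr p)"
      using p by (intro tendsto_ennrealI tendsto_powr' tendsto_rabs elim) auto
    moreover have "\<bar>real (Suc n) * (V (x + 1 / real (Suc n)) - V x)\<bar> = \<bar>V (x + d n) - V x\<bar> / d n" for n
      by (simp add: d_def abs_mult mult.commute del: of_nat_Suc)
    ultimately show ?case by (simp only: q_def)
  qed
  have "(\<integral>\<^sup>+ x. ennreal (\<bar>g x\<bar> powr p) * indicator {0<..} x \<partial>lebesgue)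
      = (\<integral>\<^sup>+ x. liminf (\<lambda>n. q n x * indicator {0<..} x) \<partial>lebesgue)"
  proof (rule nn_integral_cong_AE, use lim in eventually_elim)
    case (elim x)
    then have "(\<lambda>n. q n x * indicator {0<..} x) \<longlonglongrightarrow> ennreal (\<bar>g x\<bar> powr p) * indicator {0<..} x"
      by (auto simp: indicator_def)
    then show ?case by (simp add: lim_imp_Liminf)
  qed
  also have "\<dots> = (\<integral>\<^sup>+ x. liminf (\<lambda>n. q n x * indicator {0<..} x) \<partial>lborel)"
    by (rule nn_integral_completion)
  also have "\<dots> \<le> liminf (\<lambda>n. \<integral>\<^sup>+ x. q n x * indicator {0<..} x \<partial>lborel)"
    by (intro nn_integral_liminf) measurable
  also have "\<dots> \<le> liminf (\<lambda>n. ennreal K)"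
    by (intro Liminf_mono always_eventually allI q_le)
  also have "\<dots> = ennreal K" by (simp add: Liminf_const)
  finally show ?thesis .
qed


text \<open>
  The open set is approximated from inside by cells of a uniform partition.  By
  \<open>powr_tangent_split\<close>, the increment over each cell is at most \<open>c\<close> times its length plus its share
  of the Riesz sum divided by \<open>c powr (p - 1)\<close>.
\<close>

lemma interval_measure_open_le:
  fixes F :: "real \<Rightarrow> real"
  assumes mono: "\<And>x y. x \<le> y \<Longrightarrow> F x \<le> F y" and rc: "\<And>a. continuous (at_right a) F"
    and bd: "riesz_bound p K F" and p: "1 < p" and K: "0 \<le> K" and c: "0 < c" and U: "open U"
  shows "emeasure (interval_measure F) (U \<inter> {0<..}) \<le> ennreal c * emeasure lborel U + ennreal (K / c powr (p - 1))"
proof -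
  let ?\<nu> = "interval_measure F"
  define d where "d n = 1 / real (Suc n)" for n
  have d: "d n > 0" for n by (simp add: d_def)
  define I where "I n k = {real k * d n<..real (Suc k) * d n}" for n k
  (* The cap on the number of cells keeps T n finite; it exhausts the half-line as n grows. *)
  define T where "T n = {k. k < Suc n * Suc n \<and> I n k \<subseteq> U}" for n
  define W where "W n = (\<Union>k\<in>T n. I n k)" for n
  have fin: "finite (T n)" for n unfolding T_def by (rule finite_subset[of _ "{..<Suc n * Suc n}"]) auto
  have I_sets: "I n k \<in> sets borel" for n k by (simp add: I_def)
  have W_sets: "W n \<in> sets borel" for n unfolding W_def using fin I_sets by (intro sets.finite_UN) auto
  have gmono: "real j * d n \<le> real i * d n" if "j \<le> i" for i j n
    using that d[of n] by (simp add: mult_right_mono)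
  have disj: "disjoint_family_on (I n) (T n)" for n
    using uniform_cells_disjoint[of "d n"] d[of n]
    by (auto simp: I_def disjoint_family_on_def simp del: of_nat_Suc)
  have W_le: "emeasure ?\<nu> (W n) \<le> ennreal c * emeasure lborel U + ennreal (K / c powr (p - 1))" for n
  proof -
    define D where "D k = F (real (Suc k) * d n) - F (real k * d n)" for k
    have D: "0 \<le> D k" for k unfolding D_def using mono[OF gmono[of k "Suc k" n]] by simp
    have "emeasure ?\<nu> (W n) = (\<Sum>k\<in>T n. emeasure ?\<nu> (I n k))"
      unfolding W_def using I_sets by (intro sum_emeasure[symmetric] disj fin) auto
    also have "\<dots> = (\<Sum>k\<in>T n. ennreal (D k))"
      unfolding I_def D_def using gmono[of _ "Suc _" n] by (intro sum.cong emeasure_interval_measure_Ioc mono rc) auto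
    also have "\<dots> \<le> (\<Sum>k\<in>T n. ennreal (c * d n + D k powr p / d n powr (p - 1) / c powr (p - 1)))"
      using D d c p by (intro sum_mono ennreal_leI powr_tangent_split) auto
    also have "\<dots> = ennreal (\<Sum>k\<in>T n. c * d n + D k powr p / d n powr (p - 1) / c powr (p - 1))"
      using c d[of n] by (intro sum_ennreal) auto
    also have "\<dots> \<le> ennreal (c * (\<Sum>k\<in>T n. d n) + K / c powr (p - 1))"
    proof (rule ennreal_leI)
      have "(\<Sum>k\<in>T n. D k powr p / d n powr (p - 1)) \<le> (\<Sum>k<Suc n * Suc n. D k powr p / d n powr (p - 1))"
        by (rule sum_mono2) (auto simp: T_def)
      also have "\<dots> \<le> K"
      proof -
        have "\<bar>F (0 + real k * d n) - F (0 + real (Suc k) * d n)\<bar> = D k" for k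
          using D[of k] by (simp add: D_def abs_minus_commute)
        then show ?thesis using riesz_boundD[OF bd order_refl d[of n], of "Suc n * Suc n"] by simp
      qed
      finally have "(\<Sum>k\<in>T n. D k powr p / d n powr (p - 1)) / c powr (p - 1) \<le> K / c powr (p - 1)"
        by (intro divide_right_mono) auto
      then show "(\<Sum>k\<in>T n. c * d n + D k powr p / d n powr (p - 1) / c powr (p - 1)) \<le> c * (\<Sum>k\<in>T n. d n) + K / c powr (p - 1)"
        by (simp add: sum.distrib sum_divide_distrib sum_distrib_left)
    qed
    also have "\<dots> = ennreal c * ennreal (\<Sum>k\<in>T n. d n) + ennreal (K / c powr (p - 1))"
      using c d[of n] K by (simp add: ennreal_plus ennreal_mult sum_nonneg)
    also have "ennreal (\<Sum>k\<in>T n. d n) = (\<Sum>k\<in>T n. emeasure lborel (I n k))"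
    proof -
      have "emeasure lborel (I n k) = ennreal (d n)" for k
        using gmono[of k "Suc k" n] by (simp add: I_def algebra_simps)
      then show ?thesis using d[of n] sum_ennreal[of "T n" "\<lambda>_. d n"] by simp
    qed
    also have "\<dots> = emeasure lborel (W n)"
      unfolding W_def using I_sets by (intro sum_emeasure disj fin) auto
    also have "\<dots> \<le> emeasure lborel U"
      by (rule emeasure_mono) (use U in \<open>auto simp: W_def T_def\<close>)
    finally show ?thesis by (simp add: mult_left_mono)
  qed
  have in_W: "\<forall>\<^sub>F n in sequentially. x \<in> W n" if x: "x \<in> U" "x > 0" for x
  proof -
    obtain e where e: "e > 0" "ball x e \<subseteq> U" using U x(1) open_contains_ball by blast
    obtain n0 :: nat where n0: "1 / e < real n0" using reals_Archimedean2 by blast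
    obtain n1 :: nat where n1: "x < real n1" using reals_Archimedean2 by blast
    show ?thesis
      using eventually_ge_at_top[of "max n0 n1"]
    proof eventually_elim
      case (elim n)
      obtain k where k: "real k * d n < x" "x \<le> real (Suc k) * d n"
        by (rule uniform_cell_containing[OF d x(2)])
      then have xI: "x \<in> I n k" by (simp add: I_def)
      have "real k < x * real (Suc n)" using k(1) by (simp add: d_def field_simps)
      also have "\<dots> \<le> real (Suc n) * real (Suc n)"
        using n1 elim by (intro mult_right_mono) auto
      finally have kn: "k < Suc n * Suc n" by (simp only: of_nat_mult[symmetric] of_nat_less_iff)
      have "1 / e < real (Suc n)" using n0 elim by auto
      then have dn: "d n < e" using e(1) by (simp add: d_def field_simps)
      have "I n k \<subseteq> ball x e"
      proof
        fix y assume "y \<in> I n k"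
        moreover have "real (Suc k) * d n = real k * d n + d n" by (simp add: algebra_simps)
        ultimately have "\<bar>x - y\<bar> < d n" using xI by (auto simp: I_def)
        then show "y \<in> ball x e" using dn by (simp add: dist_real_def)
      qed
      then have "k \<in> T n" using kn e(2) by (auto simp: T_def)
      with xI show ?case by (auto simp: W_def)
    qed
  qed
  have "emeasure ?\<nu> (U \<inter> {0<..}) = (\<integral>\<^sup>+ x. indicator (U \<inter> {0<..}) x \<partial>?\<nu>)"
    using U by (intro nn_integral_indicator[symmetric]) auto
  also have "\<dots> \<le> (\<integral>\<^sup>+ x. liminf (\<lambda>n. indicator (W n) x) \<partial>?\<nu>)"
  proof (intro nn_integral_mono)
    fix x
    show "indicator (U \<inter> {0<..}) x \<le> liminf (\<lambda>n. indicator (W n) x :: ennreal)"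
    proof (cases "x \<in> U \<inter> {0<..}")
      case True
      then have "\<forall>\<^sub>F n in sequentially. (1 :: ennreal) \<le> indicator (W n) x"
        using in_W[of x] by (auto elim: eventually_mono)
      then have "1 \<le> liminf (\<lambda>n. indicator (W n) x :: ennreal)" by (rule Liminf_bounded)
      then show ?thesis using True by simp
    qed simp
  qed
  also have "\<dots> \<le> liminf (\<lambda>n. \<integral>\<^sup>+ x. indicator (W n) x \<partial>?\<nu>)"
    using W_sets by (intro nn_integral_liminf) auto
  also have "\<dots> = liminf (\<lambda>n. emeasure ?\<nu> (W n))"
    using W_sets by simp
  also have "\<dots> \<le> limsup (\<lambda>n. emeasure ?\<nu> (W n))"
    by (rule Liminf_le_Limsup) simp
  also have "\<dots> \<le> ennreal c * emeasure lborel U + ennreal (K / c powr (p - 1))"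
    by (intro Limsup_bounded always_eventually allI W_le)
  finally show ?thesis .
qed

text \<open>
  Choosing first \<open>c\<close> large and then an open cover of measure small compared with \<open>1 / c\<close> makes
  both terms of \<open>interval_measure_open_le\<close> small.
\<close>

lemma interval_measure_absolutely_continuous:
  fixes F :: "real \<Rightarrow> real"
  assumes mono: "\<And>x y. x \<le> y \<Longrightarrow> F x \<le> F y" and rc: "\<And>a. continuous (at_right a) F"
    and bd: "riesz_bound p K F" and p: "1 < p" and K: "0 \<le> K" and const: "\<And>x. x \<le> 0 \<Longrightarrow> F x = F 0"
  shows "absolutely_continuous lborel (interval_measure F)"
  unfolding absolutely_continuous_def
proof
  let ?\<nu> = "interval_measure F"
  fix N :: "real set" assume N: "N \<in> null_sets lborel"
  then have N_sets: "N \<in> sets borel" by auto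
  have left: "emeasure ?\<nu> {..0} = 0"
  proof -
    have "{..0::real} = (\<Union>n. {- real n<..0})"
    proof (intro set_eqI iffI)
      fix x :: real assume "x \<in> {..0}"
      moreover obtain n where "- x < real n" using reals_Archimedean2 by blast
      ultimately show "x \<in> (\<Union>n. {- real n<..0})" by (auto intro!: exI[of _ n])
    qed auto
    moreover have "emeasure ?\<nu> {- real n<..0} = 0" for n
      using emeasure_interval_measure_Ioc[of "- real n" 0 F] mono rc const[of "- real n"] by simp
    then have "(\<Union>n. {- real n<..0}) \<in> null_sets ?\<nu>"
      by (intro null_sets_UN null_setsI) auto
    ultimately show ?thesis by auto
  qed
  have right: "emeasure ?\<nu> (N \<inter> {0<..}) \<le> 0"
  proof (rule ennreal_le_epsilon)
    fix e :: real assume e: "e > 0"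
    obtain c where c: "c > 0" "K / c powr (p - 1) < e / 2"
      using powr_small[OF K p, of "e / 2"] e by auto
    have "e / (2 * c) > 0" using e c by simp
    from outer_regular_lborel[OF N_sets this] obtain U where U: "open U" "N \<subseteq> U"
      "emeasure lborel (U - N) < ennreal (e / (2 * c))" by blast
    have "emeasure lborel U \<le> emeasure lborel (N \<union> (U - N))"
      using N_sets U by (intro emeasure_mono) auto
    also have "\<dots> \<le> emeasure lborel N + emeasure lborel (U - N)"
      using N_sets U(1) by (intro emeasure_subadditive) auto
    also have "\<dots> \<le> ennreal (e / (2 * c))" using N U(3) by (simp add: null_setsD1)
    finally have U_le: "emeasure lborel U \<le> ennreal (e / (2 * c))" .
    have "emeasure ?\<nu> (N \<inter> {0<..}) \<le> emeasure ?\<nu> (U \<inter> {0<..})"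
      using U by (intro emeasure_mono) auto
    also have "\<dots> \<le> ennreal c * emeasure lborel U + ennreal (K / c powr (p - 1))"
      by (rule interval_measure_open_le[OF mono rc bd p K c(1) U(1)])
    also have "\<dots> \<le> ennreal c * ennreal (e / (2 * c)) + ennreal (e / 2)"
      using U_le c by (intro add_mono mult_left_mono ennreal_leI) auto
    also have "\<dots> = ennreal e"
      using c e by (simp add: ennreal_mult[symmetric] ennreal_plus[symmetric] del: ennreal_plus)
    finally show "emeasure ?\<nu> (N \<inter> {0<..}) \<le> 0 + ennreal e" by simp
  qed
  have "emeasure ?\<nu> N \<le> emeasure ?\<nu> ((N \<inter> {0<..}) \<union> {..0})"
    using N_sets by (intro emeasure_mono) auto
  also have "\<dots> \<le> emeasure ?\<nu> (N \<inter> {0<..}) + emeasure ?\<nu> {..0}"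
    using N_sets by (intro emeasure_subadditive) auto
  also have "\<dots> = 0" using left right by simp
  finally show "N \<in> null_sets ?\<nu>" using N_sets by (intro null_setsI) auto
qed

text \<open>The derivative of \<open>F\<close> is the Radon-Nikodym density of its Stieltjes measure.\<close>

lemma absolutely_continuous_interval_measure_primitive:
  fixes F :: "real \<Rightarrow> real"
  assumes mono: "\<And>x y. x \<le> y \<Longrightarrow> F x \<le> F y" and rc: "\<And>a. continuous (at_right a) F"
    and ac: "absolutely_continuous lborel (interval_measure F)"
  obtains h where "is_primitive F h"
proof -
  obtain f where f[measurable]: "f \<in> borel_measurable lborel" and dens: "density lborel f = interval_measure F"
    using sigma_finite_measure.Radon_Nikodym[OF sigma_finite_lborel ac] by auto
  define h where "h x = enn2real (f x)" for x
  have [measurable]: "h \<in> borel_measurable borel" unfolding h_def by measurable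
  have hi: "((\<lambda>x. h x * indicator {a<..b} x) has_integral (F b - F a)) UNIV" if ab: "a \<le> b" for a b
  proof (rule nn_integral_has_integral)
    have *: "(\<integral>\<^sup>+ x. f x * indicator {a<..b} x \<partial>lborel) = ennreal (F b - F a)"
    proof -
      have "emeasure (density lborel f) {a<..b} = ennreal (F b - F a)"
        unfolding dens by (rule emeasure_interval_measure_Ioc[OF ab]) (use mono rc in auto)
      then show ?thesis by (subst (asm) emeasure_density) auto
    qed
    have "AE x in lborel. f x * indicator {a<..b} x \<noteq> \<infinity>"
      by (rule nn_integral_noteq_infinite) (auto simp: *)
    then have "AE x in lborel. ennreal (h x * indicator {a<..b} x) = f x * indicator {a<..b} x"
      by eventually_elim (auto simp: h_def indicator_def less_top)
    then show "(\<integral>\<^sup>+ x. ennreal (h x * indicator {a<..b} x) \<partial>lborel) = ennreal (F b - F a)"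
      unfolding *[symmetric] by (rule nn_integral_cong_AE)
    show "0 \<le> F b - F a" using mono[OF ab] by simp
  qed (auto simp: h_def)
  have hi': "(h has_integral (F b - F a)) {a..b}" if ab: "a \<le> b" for a b
  proof -
    have "(\<lambda>x. h x * indicator {a<..b} x) = (\<lambda>x. if x \<in> {a<..b} then h x else 0)"
      by (auto simp: indicator_def)
    then have "(h has_integral (F b - F a)) {a<..b}"
      using hi[OF ab] by (simp only: has_integral_restrict_UNIV)
    moreover have "negligible {x \<in> {a<..b} - {a..b}. h x \<noteq> 0}"
      by (rule negligible_subset[OF negligible_empty]) auto
    moreover have "negligible {x \<in> {a..b} - {a<..b}. h x \<noteq> 0}"
      by (rule negligible_subset[OF negligible_sing[of a]]) auto
    ultimately show ?thesis
      by (simp only: has_integral_spike_set_eq[of "{a<..b}" "{a..b}" h])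
  qed
  have "h absolutely_integrable_on {a..b}" for a b
  proof (cases "a \<le> b")
    case True
    then show ?thesis using hi'[OF True]
      by (intro nonnegative_absolutely_integrable_1) (auto simp: h_def has_integral_integrable)
  qed (simp add: absolutely_integrable_on_def)
  moreover have "F b - F a = integral {a..b} h" if "a \<le> b" for a b
    using hi'[OF that] by (simp add: integral_unique)
  ultimately show ?thesis
    by (intro that[of h]) (auto simp: is_primitive_def locally_integrable_def)
qed

lemma riesz_bound_increment_small:
  assumes bd: "riesz_bound p K V" and p: "1 < p" and K: "0 \<le> K" and e: "\<epsilon> > 0"
  obtains d where "d > 0" "\<And>x y. 0 \<le> x \<Longrightarrow> x < y \<Longrightarrow> y < x + d \<Longrightarrow> \<bar>V x - V y\<bar> < \<epsilon>"
proof -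
  obtain c where c: "c > 0" "K / c powr (p - 1) < \<epsilon> / 2"
    using powr_small[OF K p, of "\<epsilon> / 2"] e by auto
  show ?thesis
  proof (rule that[of "\<epsilon> / (2 * c)"])
    show "\<epsilon> / (2 * c) > 0" using c e by simp
    fix x y :: real assume xy: "0 \<le> x" "x < y" "y < x + \<epsilon> / (2 * c)"
    have "\<bar>V x - V y\<bar> powr p / (y - x) powr (p - 1) \<le> K"
      using riesz_boundD[OF bd xy(1), of "y - x" 1] xy by simp
    then have "\<bar>V x - V y\<bar> powr p / (y - x) powr (p - 1) / c powr (p - 1) \<le> K / c powr (p - 1)"
      by (intro divide_right_mono) auto
    moreover have "\<bar>V x - V y\<bar> \<le> c * (y - x) + \<bar>V x - V y\<bar> powr p / (y - x) powr (p - 1) / c powr (p - 1)"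
      using xy c p by (intro powr_tangent_split) auto
    moreover have "c * (y - x) < \<epsilon> / 2" using xy(3) c by (simp add: field_simps)
    ultimately show "\<bar>V x - V y\<bar> < \<epsilon>" using c(2) by linarith
  qed
qed

text \<open>
  The measure is built from \<open>- V\<close> on the half-line, continued by a constant; evenness glues the
  two halves of \<open>V\<close> together from \<open>F\<close> and its reflection.
\<close>

lemma riesz_bound_imp_primitive:
  assumes even: "\<And>x. V (- x) = V x" and decr: "\<And>x y. 0 \<le> x \<Longrightarrow> x \<le> y \<Longrightarrow> V y \<le> V x"
    and bd: "riesz_bound p K V" and p: "1 < p" and K: "0 \<le> K"
  obtains g where "is_primitive V g"
proof -
  define F where "F x = - V (max 0 x)" for x
  have mono: "F x \<le> F y" if "x \<le> y" for x y
    unfolding F_def using decr[of "max 0 x" "max 0 y"] that by simp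
  have bdF: "riesz_bound p K F"
    unfolding riesz_bound_def
  proof (intro allI impI)
    fix \<theta> \<delta> :: real and N assume td: "0 \<le> \<theta>" "0 < \<delta>"
    have "\<bar>F (\<theta> + real j * \<delta>) - F (\<theta> + real (Suc j) * \<delta>)\<bar> = \<bar>V (\<theta> + real j * \<delta>) - V (\<theta> + real (Suc j) * \<delta>)\<bar>" for j
    proof -
      have "max 0 (\<theta> + real i * \<delta>) = \<theta> + real i * \<delta>" for i using td by simp
      then show ?thesis by (simp add: F_def abs_minus_commute del: of_nat_Suc)
    qed
    then show "(\<Sum>j<N. \<bar>F (\<theta> + real j * \<delta>) - F (\<theta> + real (Suc j) * \<delta>)\<bar> powr p / \<delta> powr (p - 1)) \<le> K"
      using riesz_boundD[OF bd td] by simp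
  qed
  have rc: "continuous (at_right a) F" for a
    unfolding continuous_within
  proof (rule tendstoI)
    fix e :: real assume "e > 0"
    from riesz_bound_increment_small[OF bd p K this] obtain d where
      d: "d > 0" "\<And>x y. 0 \<le> x \<Longrightarrow> x < y \<Longrightarrow> y < x + d \<Longrightarrow> \<bar>V x - V y\<bar> < e" by blast
    have "dist (F x) (F a) < e" if "a < x" "x < a + d" for x
      using d(2)[of "max 0 a" "max 0 x"] that \<open>e > 0\<close>
      by (cases "max 0 a = max 0 x") (auto simp: F_def dist_real_def max_def split: if_splits)
    then show "\<forall>\<^sub>F x in at_right a. dist (F x) (F a) < e"
      using d(1) by (intro eventually_at_rightI[of a "a + d"]) auto
  qed
  have ac: "absolutely_continuous lborel (interval_measure F)"
    by (rule interval_measure_absolutely_continuous[OF mono rc bdF p K]) (simp_all add: F_def)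
  obtain h where h: "is_primitive F h"
    by (rule absolutely_continuous_interval_measure_primitive[OF mono rc ac])
  have V: "V x = - F x - F (- x) + F 0" for x
    using even[of x] by (auto simp: F_def max_def)
  note l = is_primitiveD(1)[OF h] and l' = is_primitiveD(1)[OF is_primitive_reflect[OF h]]
  have "is_primitive V (\<lambda>x. (-1) * (h x + - h (- x)))"
    unfolding is_primitive_def
  proof (intro conjI allI impI)
    show "locally_integrable (\<lambda>x. (-1) * (h x + - h (- x)))"
      by (intro locally_integrable_cmult locally_integrable_add l l')
    fix a b :: real assume ab: "a \<le> b"
    have "integral {a..b} (\<lambda>x. (-1) * (h x + - h (- x))) = - (integral {a..b} h + integral {a..b} (\<lambda>x. - h (- x)))"
      unfolding integral_mult_right
      using integral_add[OF locally_integrableD(2)[OF l] locally_integrableD(2)[OF l']] by simp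
    then show "V b - V a = integral {a..b} (\<lambda>x. (-1) * (h x + - h (- x)))"
      using is_primitiveD(2)[OF h ab] is_primitiveD(2)[OF is_primitive_reflect[OF h] ab]
      by (simp add: V[of a] V[of b])
  qed
  then show ?thesis by (rule that)
qed

section \<open>The energy of the rearrangement\<close>

text \<open>
  The density of an even function is odd almost everywhere, by uniqueness.
\<close>

lemma even_energy_split:
  fixes g :: "real \<Rightarrow> real"
  assumes V: "is_primitive V g" and even: "\<And>x. V (- x) = V x"
  shows "(\<integral>\<^sup>+ x. ennreal (\<bar>g x\<bar> powr p) \<partial>lebesgue)
       = 2 * (\<integral>\<^sup>+ x. ennreal (\<bar>g x\<bar> powr p) * indicator {0<..} x \<partial>lebesgue)"
proof -
  define f where "f x = ennreal (\<bar>g x\<bar> powr p)" for x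
  have [measurable]: "g \<in> borel_measurable lebesgue"
    by (rule locally_integrable_measurable[OF is_primitiveD(1)[OF V]])
  have f_meas[measurable]: "f \<in> borel_measurable lebesgue" unfolding f_def by measurable
  have "is_primitive V (\<lambda>x. - g (- x))"
    using is_primitive_reflect[OF V] even by simp
  from is_primitive_AE_unique[OF V this] have sym: "AE x in lebesgue. f (- x) = f x"
    by eventually_elim (simp add: f_def)
  have "(\<integral>\<^sup>+ x. f x * indicator {..<0} x \<partial>lebesgue) = (\<integral>\<^sup>+ x. f (- x) * indicator {..<0} (- x) \<partial>lebesgue)"
  proof -
    have "(\<lambda>x. f x * indicator {..<0} x) \<in> borel_measurable lebesgue"
      by (intro borel_measurable_times_ennreal f_meas borel_measurable_indicator) auto
    from nn_integral_real_affine_lebesgue[OF this, of "-1" 0] show ?thesis by simp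
  qed
  also have "\<dots> = (\<integral>\<^sup>+ x. f x * indicator {0<..} x \<partial>lebesgue)"
    by (rule nn_integral_cong_AE, use sym in eventually_elim) (simp add: indicator_def)
  finally have left: "(\<integral>\<^sup>+ x. f x * indicator {..<0} x \<partial>lebesgue) = (\<integral>\<^sup>+ x. f x * indicator {0<..} x \<partial>lebesgue)" .
  have "AE x in lebesgue. x \<noteq> (0::real)"
    using AE_lborel_singleton[of "0::real"] by (rule AE_completion)
  then have "(\<integral>\<^sup>+ x. f x \<partial>lebesgue) = (\<integral>\<^sup>+ x. f x * indicator {..<0} x + f x * indicator {0<..} x \<partial>lebesgue)"
    by (intro nn_integral_cong_AE) (auto elim!: eventually_mono simp: indicator_def)
  also have "\<dots> = (\<integral>\<^sup>+ x. f x * indicator {..<0} x \<partial>lebesgue) + (\<integral>\<^sup>+ x. f x * indicator {0<..} x \<partial>lebesgue)"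
    by (intro nn_integral_add borel_measurable_times_ennreal f_meas borel_measurable_indicator) auto
  finally show ?thesis unfolding left mult_2[symmetric] by (simp only: f_def)
qed

lemma has_weak_derivative_weak_deriv:
  "has_weak_derivative f g \<Longrightarrow> has_weak_derivative f (weak_deriv f)"
  unfolding weak_deriv_def by (rule someI[of "has_weak_derivative f"])

(* The rearrangement of a continuous compactly supported function is finite everywhere,
   so enn2real loses nothing here. *)
theorem proposition2p1:
  fixes p \<kappa> :: real and u :: "real \<Rightarrow> real"
  assumes "2 \<le> p"
    and "u \<in> W1p p"
    and "continuous_on UNIV u"
    and "compactly_supported u"
  shows "(\<integral>\<^sup>+ x. ennreal (\<bar>weak_deriv u x + \<kappa> * u x\<bar> powr p) \<partial>lebesgue)
       \<ge> (\<integral>\<^sup>+ x. ennreal (\<bar>weak_deriv (\<lambda>y. enn2real (symm_decr_rearrangement u y)) x\<bar> powr p)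
            \<partial>lebesgue)"
proof (cases "(\<integral>\<^sup>+ x. ennreal (\<bar>weak_deriv u x + \<kappa> * u x\<bar> powr p) \<partial>lebesgue) = top")
  case True
  then show ?thesis by simp
next
  case False
  define E where "E = enn2real (\<integral>\<^sup>+ x. ennreal (\<bar>weak_deriv u x + \<kappa> * u x\<bar> powr p) \<partial>lebesgue)"
  have E: "0 \<le> E" "(\<integral>\<^sup>+ x. ennreal (\<bar>weak_deriv u x + \<kappa> * u x\<bar> powr p) \<partial>lebesgue) = ennreal E"
    using False by (auto simp: E_def less_top)
  note cont = assms(3) and sup = assms(4)
  obtain g where "has_weak_derivative u g" using assms(2) by (auto simp: W1p_def)
  then have u: "is_primitive u (weak_deriv u)"
    by (intro weak_derivative_imp_is_primitive[OF cont] has_weak_derivative_weak_deriv)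
  let ?V = "rearr u"
  have bd: "riesz_bound p (E / 2) ?V"
    unfolding riesz_bound_def
  proof (intro allI impI)
    fix \<theta> \<delta> :: real and N assume td: "0 \<le> \<theta>" "0 < \<delta>"
    let ?t = "\<lambda>j. \<bar>?V (\<theta> + real j * \<delta>) - ?V (\<theta> + real (Suc j) * \<delta>)\<bar> powr p / \<delta> powr (p - 1)"
    have "\<bar>?V (\<theta> + real j * \<delta>) - ?V (\<theta> + real (Suc j) * \<delta>)\<bar> = ?V (\<theta> + real j * \<delta>) - ?V (\<theta> + real (Suc j) * \<delta>)" for j
      using rearr_antimono[OF cont sup, of "\<theta> + real j * \<delta>" "\<theta> + real (Suc j) * \<delta>"] td
      by (simp add: mult_right_mono)
    then have "(\<Sum>j<N. ennreal (2 * ?t j)) \<le> ennreal E"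
      using rearr_partition_energy[OF assms(1) u sup td(2,1), of N \<kappa>] E(2) by simp
    also have "(\<Sum>j<N. ennreal (2 * ?t j)) = ennreal (\<Sum>j<N. 2 * ?t j)"
      by (rule sum_ennreal) simp
    finally have "(\<Sum>j<N. 2 * ?t j) \<le> E" using E(1) by (simp add: ennreal_le_iff)
    moreover have "(\<Sum>j<N. 2 * ?t j) = 2 * (\<Sum>j<N. ?t j)" by (rule sum_distrib_left[symmetric])
    ultimately show "(\<Sum>j<N. ?t j) \<le> E / 2" by linarith
  qed
  have decr: "?V y \<le> ?V x" if "0 \<le> x" "x \<le> y" for x y
    using that by (intro rearr_antimono[OF cont sup]) auto
  have p: "1 < p" "0 \<le> E / 2" using assms(1) E(1) by auto
  obtain h where h: "is_primitive ?V h"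
    by (rule riesz_bound_imp_primitive[where V = ?V, OF rearr_minus decr bd p]) (assumption | rule that)+
  then have "has_weak_derivative ?V (weak_deriv ?V)"
    by (rule has_weak_derivative_weak_deriv[OF is_primitive_imp_weak_derivative])
  then have V: "is_primitive ?V (weak_deriv ?V)"
    by (rule weak_derivative_imp_is_primitive[OF is_primitive_continuous[OF h]])
  have "(\<integral>\<^sup>+ x. ennreal (\<bar>weak_deriv ?V x\<bar> powr p) \<partial>lebesgue) \<le> 2 * ennreal (E / 2)"
    unfolding even_energy_split[OF V rearr_minus]
    by (rule mult_left_mono[OF riesz_bound_energy[OF V _ bd p(2)]]) (use p in auto)
  also have "\<dots> = ennreal E"
    using E(1) ennreal_mult[of 2 "E / 2"] by simp
  finally show ?thesis
    unfolding E(2) rearr_def[abs_def] .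
qed

end
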